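(* Let $X$ be an MCS space. Then $X$, equipped with its MCS stratification, is a CS set. Moreover, the MCS stratification of $X$ coincides with the intrinsic stratification of $X$, i.e. $\{x\in X:\mathfrak{I}(X,x)\le i\}=\{x\in X: I(X,x)\le i\}$ for every $i\geq 0$.
   Context: Cones. For a compact space $L$, $cL=L\times[0,\infty)/(L\times\{0\})$ is the open cone with vertex $o$; $c\varnothing$ is the single point $o$. In $\mathbb{R}^m\times cL$ the symbol $o$ also denotes $(0,o)$. A compactum is a compact metrizable space. MCS spaces. A metrizable space $X$ is an MCS space of dimension $n$ if for every $p\in X$ there exist a neighbourhood $U_p$ of $p$, a compact MCS space $L$ of dimension $n-1$, and a homeomorphism $U_p\to cL$ taking $p$ to $o$. The unique MCS space of dimension $-1$ is the empty set. An MCS space is an MCS space of some dimension $n$. MCS stratification. For $x\in X$, $\mathfrak{I}(X,x)$ is the supremum of all integers $m\ge 0$ such that there exist a neighbourhood $U_x$ of $x$, a compact MCS space $L$, and a homeomorphism $U_x\to\mathbb{R}^m\times cL$ taking $x$ to $o$. The MCS stratification is the filtration $X^{(i)}=\{x\in X:\mathfrak{I}(X,x)\le i\}$, with $X^{(-1)}=\varnothing$. Intrinsic stratification. $I(X,x)$ is defined as $\mathfrak{I}(X,x)$, except that $L$ is only required to be a compactum (not necessarily MCS). The intrinsic stratification is the filtration by the sets $\{x\in X: I(X,x)\le i\}$. Stratified sets. A stratified set is a metrizable space $X$ with a filtration $\varnothing=X^{(-1)}\subseteq X^{(0)}\subseteq X^{(1)}\subseteq\cdots\subseteq X$ by closed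 subsets such that the components of each stratum $X[i]=X^{(i)}-X^{(i-1)}$ are open in $X[i]$. An isomorphism of stratified sets is a homeomorphism $h:X\to Y$ with $h(X^{(n)})=Y^{(n)}$ for all $n\ge 0$. The product of stratified sets is stratified by $(X\times Y)^{(i)}=\bigcup_{a+b=i}X^{(a)}\times Y^{(b)}$. If $L$ is a compact stratified set, $cL$ is stratified by $(cL)^{(-1)}=\varnothing$, $(cL)^{(0)}=\{o\}$, $(cL)^{(i)}=c(L^{(i-1)})$ for $i\ge1$. A topological $i$-manifold $U$ without boundary is stratified by $U^{(k)}=\varnothing$ for $k<i$ and $U^{(k)}=U$ for $k\geq i$. CS sets. A stratified set $X$ is a CS set if (1) each stratum $X[i]$ is a topological manifold of dimension $i$ without boundary; (2) for each $p\in X$, say $p\in X[i]$, there exist an open neighbourhood $U$ of $p$ in $X[i]$, a compact stratified set $L$ (a link of $p$), and an isomorphism of $U\times cL$ onto a neighbourhood $N$ of $p$ in $X$, where $N$ is filtered by $N\cap X^{(k)}$. The stratification of $L$ is not required to be a CS stratification. *)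

theory Defs
  imports "HOL-Analysis.Analysis" "HOL-Library.Extended_Nat"
begin

subsection \<open>Open cones\<close>

text \<open>
  The points of the open cone on \<open>L\<close> are encoded as options: \<open>None\<close> is the vertex, \<open>Some (x, t)\<close>
  with \<open>t > 0\<close> the class of \<open>(x, t)\<close>.  The topology is the quotient topology along \<open>cone_proj\<close>
  (lemma \<open>quotient_map_cone_proj\<close>); the carrier always contains the vertex, so the
  cone on the empty space is a point (lemma \<open>topspace_open_cone_empty\<close>).
\<close>

type_synonym 'a cone = "('a \<times> real) option"

definition cone_vertex :: "'a cone"
  where "cone_vertex = None"

definition cone_proj :: "'a \<times> real \<Rightarrow> 'a cone"
  where "cone_proj z = (if snd z = 0 then cone_vertex else Some z)"

definition cone_set :: "'a set \<Rightarrow> 'a cone set"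
  where "cone_set A = insert cone_vertex (cone_proj ` (A \<times> {0..}))"

definition open_cone :: "'a topology \<Rightarrow> 'a cone topology"
  where "open_cone L = topology (\<lambda>W. W \<subseteq> cone_set (topspace L) \<and>
           openin (prod_topology L (top_of_set {0..}))
             {z \<in> topspace L \<times> {0..}. cone_proj z \<in> W})"

lemma openin_open_cone:
  "openin (open_cone L) W \<longleftrightarrow> W \<subseteq> cone_set (topspace L) \<and>
     openin (prod_topology L (top_of_set {0..})) {z \<in> topspace L \<times> {0..}. cone_proj z \<in> W}"
proof -
  let ?Z = "topspace L \<times> {0..}" and ?P = "prod_topology L (top_of_set {0::real..})"
  have "istopology (\<lambda>W. W \<subseteq> cone_set (topspace L) \<and> openin ?P {z \<in> ?Z. cone_proj z \<in> W})"
    unfolding istopology_def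
  proof (intro conjI allI impI)
    fix S T
    assume "S \<subseteq> cone_set (topspace L) \<and> openin ?P {z \<in> ?Z. cone_proj z \<in> S}"
      and "T \<subseteq> cone_set (topspace L) \<and> openin ?P {z \<in> ?Z. cone_proj z \<in> T}"
    moreover have "{z \<in> ?Z. cone_proj z \<in> S \<inter> T} =
        {z \<in> ?Z. cone_proj z \<in> S} \<inter> {z \<in> ?Z. cone_proj z \<in> T}" by auto
    ultimately show "S \<inter> T \<subseteq> cone_set (topspace L)"
      and "openin ?P {z \<in> ?Z. cone_proj z \<in> S \<inter> T}" by auto
  next
    fix \<K>
    assume K: "\<forall>S\<in>\<K>. S \<subseteq> cone_set (topspace L) \<and> openin ?P {z \<in> ?Z. cone_proj z \<in> S}"
    then show "\<Union>\<K> \<subseteq> cone_set (topspace L)" by auto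
    have "{z \<in> ?Z. cone_proj z \<in> \<Union>\<K>} = (\<Union>S\<in>\<K>. {z \<in> ?Z. cone_proj z \<in> S})" by auto
    then show "openin ?P {z \<in> ?Z. cone_proj z \<in> \<Union>\<K>}"
      using K by auto
  qed
  then show ?thesis
    by (simp add: open_cone_def topology_inverse')
qed

lemma topspace_open_cone: "topspace (open_cone L) = cone_set (topspace L)"
proof -
  have eq: "{z \<in> topspace L \<times> {0..}. cone_proj z \<in> cone_set (topspace L)} = topspace L \<times> {0::real..}"
    by (auto simp: cone_set_def)
  have "openin (prod_topology L (top_of_set {0::real..})) (topspace L \<times> {0..})"
    by (simp add: openin_prod_Times_iff)
  then have "openin (open_cone L) (cone_set (topspace L))"
    unfolding openin_open_cone eq by simp
  then show ?thesis
    by (meson openin_open_cone openin_subset openin_topspace subset_antisym)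
qed

lemma topspace_open_cone_empty:
  "topspace L = {} \<Longrightarrow> topspace (open_cone L) = {cone_vertex}"
  by (simp add: topspace_open_cone cone_set_def)

lemma quotient_map_cone_proj:
  assumes "topspace L \<noteq> {}"
  shows "quotient_map (prod_topology L (top_of_set {0..})) (open_cone L) cone_proj"
proof -
  obtain a where "a \<in> topspace L" using assms by blast
  then have "cone_vertex \<in> cone_proj ` (topspace L \<times> {0..})"
    by (intro image_eqI[of _ _ "(a, 0)"]) (auto simp: cone_proj_def)
  then show ?thesis
    by (auto simp: quotient_map_def topspace_open_cone openin_open_cone cone_set_def)
qed

subsection \<open>MCS spaces\<close>

definition nbhd :: "'a topology \<Rightarrow> 'a \<Rightarrow> 'a set \<Rightarrow> bool"
  where "nbhd X p U \<longleftrightarrow> U \<subseteq> topspace X \<and> p \<in> X interior_of U"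

text \<open>
  Links are compact metrizable spaces of arbitrary type.  Each of them is homeomorphic to a
  space whose points are of type \<open>nat \<Rightarrow> real\<close> (lemma \<open>compactum_homeomorphic_nat_real\<close>), so quantifying
  over topologies on subsets of this one type loses nothing.
\<close>

type_synonym link = "(nat \<Rightarrow> real) topology"

lemma compactum_homeomorphic_nat_real:
  fixes X :: "'a topology"
  assumes "compact_space X" "metrizable_space X"
  shows "\<exists>L :: link. compact_space L \<and> metrizable_space L \<and> X homeomorphic_space L"
proof -
  obtain M d where "Metric_space M d" and X: "X = Metric_space.mtopology M d"
    using assms(2) by (auto simp: metrizable_space_def)
  interpret Metric_space M d by fact
  have "mtotally_bounded M"
    using assms(1) compact_space_eq_mcomplete_mtotally_bounded X by blast
  then have "\<forall>n. \<exists>K. finite K \<and> K \<subseteq> M \<and> M \<subseteq> (\<Union>x\<in>K. mball x (inverse (Suc n)))"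
    by (simp add: mtotally_bounded_def del: of_nat_Suc)
  from choice[OF this] obtain K where K: "\<And>n. finite (K n)" "\<And>n. K n \<subseteq> M"
    "\<And>n. M \<subseteq> (\<Union>x\<in>K n. mball x (inverse (Suc n)))" by blast
  define C where "C = (\<Union>n. K n)"
  have C: "countable C" "C \<subseteq> M"
    using K by (auto simp: C_def countable_finite)
  define f where "f x n = d x (from_nat_into C n)" for x n
  have inj: "inj_on f M"
  proof (rule inj_onI, rule ccontr)
    fix x y assume xy: "x \<in> M" "y \<in> M" "f x = f y" "x \<noteq> y"
    then have "d x y > 0" by simp
    then obtain n where n: "inverse (real (Suc n)) < d x y / 2"
      using reals_Archimedean[OF half_gt_zero] by blast
    obtain c where c: "c \<in> K n" "x \<in> mball c (inverse (Suc n))"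
      using subsetD[OF K(3) xy(1), of n] by blast
    then have "c \<in> C" by (auto simp: C_def)
    then obtain k where "from_nat_into C k = c"
      using from_nat_into_surj[OF C(1)] by metis
    then have "d x c = d y c" using fun_cong[OF xy(3), of k] by (simp add: f_def)
    moreover have "d x c < d x y / 2" using c(2) n commute[of c x] by simp
    moreover have "d x y \<le> d x c + d c y" using triangle[of x c y] xy c(2) by simp
    ultimately show False using commute[of c y] by linarith
  qed
  have "continuous_map mtopology (powertop_real UNIV) f"
  proof (rule continuous_map_componentwise_UNIV[THEN iffD2], rule allI)
    fix n
    show "continuous_map mtopology euclideanreal (\<lambda>x. f x n)"
    proof (cases "C = {}")
      case True
      then have "M = {}" using K(3)[of 0] by (auto simp: C_def)
      then have "mtopology = trivial_topology" by (metis topspace_mtopology null_topspace_iff_trivial)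
      then show ?thesis by (simp only: continuous_map_on_empty)
    next
      case False
      then have "from_nat_into C n \<in> M" using subsetD[OF C(2) from_nat_into] by simp
      then have "continuous_map mtopology euclideanreal (d (from_nat_into C n))"
        using continuous_on_mdist[of "from_nat_into C n" Self]
        by (simp only: mtopology_of_def mspace_Self mdist_Self)
      moreover have "(\<lambda>x. f x n) = d (from_nat_into C n)"
        by (rule ext) (simp only: f_def commute)
      ultimately show ?thesis by simp
    qed
  qed
  then have "embedding_map X (powertop_real UNIV) f"
    using assms(1) inj unfolding X
    by (intro continuous_imp_embedding_map) (simp_all add: euclidean_product_topology)
  then have L: "X homeomorphic_space subtopology (powertop_real UNIV) (f ` topspace X)"
    unfolding embedding_map_def by (rule homeomorphic_map_imp_homeomorphic_space)
  show ?thesis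
    using assms L homeomorphic_compact_space[OF L] homeomorphic_metrizable_space[OF L] by metis
qed

definition locally_conelike :: "(link \<Rightarrow> bool) \<Rightarrow> 'a topology \<Rightarrow> bool"
  where "locally_conelike P X \<longleftrightarrow>
    (\<forall>p\<in>topspace X. \<exists>U L h. nbhd X p U \<and> compact_space L \<and> P L \<and>
       homeomorphic_map (subtopology X U) (open_cone L) h \<and> h p = cone_vertex)"

text \<open>
  The recursion on the dimension takes place on links only, since a recursive definition cannot
  change the type of the points; the argument is the dimension plus one.
  Lemma \<open>MCS_dim_step\<close> recovers the recursive characterisation for spaces of any type.
\<close>

primrec MCS_link :: "nat \<Rightarrow> link \<Rightarrow> bool" where
  "MCS_link 0 L \<longleftrightarrow> topspace L = {}"
| "MCS_link (Suc n) L \<longleftrightarrow> metrizable_space L \<and> locally_conelike (MCS_link n) L"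

definition MCS_dim :: "int \<Rightarrow> 'a topology \<Rightarrow> bool"
  where "MCS_dim n X \<longleftrightarrow>
    n = -1 \<and> topspace X = {} \<or>
    n \<ge> 0 \<and> metrizable_space X \<and> locally_conelike (MCS_link (nat n)) X"

definition MCS_space :: "'a topology \<Rightarrow> bool"
  where "MCS_space X \<longleftrightarrow> (\<exists>n. MCS_dim n X)"

lemma MCS_dim_minus_one: "MCS_dim (-1) X \<longleftrightarrow> topspace X = {}"
  by (simp add: MCS_dim_def)

lemma MCS_dim_link: "MCS_dim (int n - 1) L \<longleftrightarrow> MCS_link n L" for L :: link
  by (cases n) (auto simp: MCS_dim_def)

lemma MCS_dim_step:
  assumes "n \<ge> 0"
  shows "MCS_dim n X \<longleftrightarrow> metrizable_space X \<and>
    (\<forall>p\<in>topspace X. \<exists>U (L :: link) h. nbhd X p U \<and> compact_space L \<and> MCS_dim (n - 1) L \<and>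
       homeomorphic_map (subtopology X U) (open_cone L) h \<and> h p = cone_vertex)"
  using assms MCS_dim_link[of "nat n"]
  by (simp add: MCS_dim_def[of n X] locally_conelike_def)

subsection \<open>The MCS and intrinsic stratifications\<close>

definition Euclidean_cone_nbhd :: "'a topology \<Rightarrow> 'a \<Rightarrow> nat \<Rightarrow> 'b topology \<Rightarrow> bool"
  where "Euclidean_cone_nbhd X x m L \<longleftrightarrow>
    (\<exists>U h. nbhd X x U \<and>
       homeomorphic_map (subtopology X U) (prod_topology (Euclidean_space m) (open_cone L)) h \<and>
       h x = (\<lambda>_. 0, cone_vertex))"

text \<open>The suprema are taken in \<open>enat\<close>, so that the set of admissible \<open>m\<close> may be unbounded.\<close>

definition MCS_index :: "'a topology \<Rightarrow> 'a \<Rightarrow> enat"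
  where "MCS_index X x =
    Sup {enat m | m. \<exists>L :: link. compact_space L \<and> MCS_space L \<and> Euclidean_cone_nbhd X x m L}"

definition intrinsic_index :: "'a topology \<Rightarrow> 'a \<Rightarrow> enat"
  where "intrinsic_index X x =
    Sup {enat m | m. \<exists>L :: link. compact_space L \<and> metrizable_space L \<and> Euclidean_cone_nbhd X x m L}"

text \<open>
  A filtration \<open>F :: nat \<Rightarrow> 'a set\<close> lists the members of index \<open>0, 1, 2, \<dots>\<close>; the member of index
  \<open>-1\<close> is always empty and is left out.
\<close>

definition MCS_stratification :: "'a topology \<Rightarrow> nat \<Rightarrow> 'a set"
  where "MCS_stratification X i = {x \<in> topspace X. MCS_index X x \<le> enat i}"

definition intrinsic_stratification :: "'a topology \<Rightarrow> nat \<Rightarrow> 'a set"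
  where "intrinsic_stratification X i = {x \<in> topspace X. intrinsic_index X x \<le> enat i}"

subsection \<open>Stratified sets\<close>

definition stratum :: "(nat \<Rightarrow> 'a set) \<Rightarrow> nat \<Rightarrow> 'a set"
  where "stratum F i = F i - (if i = 0 then {} else F (i - 1))"

definition stratified_set :: "'a topology \<Rightarrow> (nat \<Rightarrow> 'a set) \<Rightarrow> bool"
  where "stratified_set X F \<longleftrightarrow>
    metrizable_space X \<and>
    (\<forall>i. closedin X (F i)) \<and>
    (\<forall>i. F i \<subseteq> F (Suc i)) \<and>
    (\<forall>i. \<forall>C \<in> connected_components_of (subtopology X (stratum F i)).
       openin (subtopology X (stratum F i)) C)"

definition stratified_iso ::
  "'a topology \<Rightarrow> (nat \<Rightarrow> 'a set) \<Rightarrow> 'b topology \<Rightarrow> (nat \<Rightarrow> 'b set) \<Rightarrow> ('a \<Rightarrow> 'b) \<Rightarrow> bool"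
  where "stratified_iso X F Y G h \<longleftrightarrow> homeomorphic_map X Y h \<and> (\<forall>n. h ` F n = G n)"

definition prod_filtration ::
  "(nat \<Rightarrow> 'a set) \<Rightarrow> (nat \<Rightarrow> 'b set) \<Rightarrow> nat \<Rightarrow> ('a \<times> 'b) set"
  where "prod_filtration F G i = (\<Union>(a, b) \<in> {(a, b). a + b = i}. F a \<times> G b)"

definition cone_filtration :: "(nat \<Rightarrow> 'a set) \<Rightarrow> nat \<Rightarrow> 'a cone set"
  where "cone_filtration F i = (if i = 0 then {cone_vertex} else cone_set (F (i - 1)))"

definition manifold_filtration :: "nat \<Rightarrow> 'a set \<Rightarrow> nat \<Rightarrow> 'a set"
  where "manifold_filtration i U k = (if k < i then {} else U)"

subsection \<open>CS sets\<close>

text \<open>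
  Manifolds are metrizable but need not be second countable: an MCS space may have uncountably
  many components.
\<close>

definition topological_manifold :: "nat \<Rightarrow> 'a topology \<Rightarrow> bool"
  where "topological_manifold n M \<longleftrightarrow>
    metrizable_space M \<and>
    (\<forall>x\<in>topspace M. \<exists>U V. openin M U \<and> x \<in> U \<and> openin (Euclidean_space n) V \<and>
       subtopology M U homeomorphic_space subtopology (Euclidean_space n) V)"

definition CS_set :: "'a topology \<Rightarrow> (nat \<Rightarrow> 'a set) \<Rightarrow> bool"
  where "CS_set X F \<longleftrightarrow>
    stratified_set X F \<and>
    (\<forall>i. topological_manifold i (subtopology X (stratum F i))) \<and>
    (\<forall>p\<in>topspace X. \<exists>i. p \<in> stratum F i \<and>
       (\<exists>U (L :: link) G N h.
          openin (subtopology X (stratum F i)) U \<and> p \<in> U \<and>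
          compact_space L \<and> stratified_set L G \<and>
          nbhd X p N \<and>
          stratified_iso
            (prod_topology (subtopology X U) (open_cone L))
            (prod_filtration (manifold_filtration i U) (cone_filtration G))
            (subtopology X N) (\<lambda>k. N \<inter> F k) h))"

end

theory Submission
  imports Defs "HOL-Homology.Invariance_of_Domain"
begin

text \<open>
  Both indices are local, and everything rests on the homogeneity of the model \<open>\<real>\<^sup>m \<times> cL\<close>.
  Translations of \<open>\<real>\<^sup>m\<close> show that the index is constant along the axis \<open>\<real>\<^sup>m \<times> {o}\<close>. Taking the
  logarithm of the radius as a further coordinate turns the complement of the axis into
  \<open>\<real>\<^sup>m\<^sup>+\<^sup>1 \<times> L\<close> (lemma \<open>open_embedding_punctured_cone_map\<close>), so that off the axis the index depends
  on the point of \<open>L\<close> alone; if \<open>L\<close> is an MCS space, a conical neighbourhood in \<open>L\<close> shows that it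
  is at least \<open>m + 1\<close> there.

  Every point \<open>x\<close> of an MCS space \<open>X\<close> of dimension \<open>n\<close> has index at most \<open>n\<close>
  (lemma \<open>Euclidean_factor_bound\<close>), so its index \<open>i\<close> is attained by an open embedding of some
  \<open>\<real>\<^sup>i \<times> cL\<close>, an \<open>MCS_chart\<close>. By the above, the stratum of \<open>x\<close> meets the chart exactly in the axis.
  Hence sublevel sets of the index are closed, strata are manifolds, and the chart itself is the
  local product structure, where \<open>L\<close> is filtered by the index along a ray of the cone. The
  strata of \<open>L\<close>, multiplied with \<open>\<real>\<^sup>i\<^sup>+\<^sup>1\<close>, become open subsets of strata of \<open>X\<close>, which are locally
  connected; so their components are open.

  For the comparison with the intrinsic index, let \<open>x\<close> have a neighbourhood \<open>\<real>\<^sup>m \<times> cK\<close> with \<open>K\<close> any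
  compactum. The MCS index is still constant along the axis of this neighbourhood, since this
  takes translations only. So the axis stays in the stratum of \<open>x\<close>, an \<open>i\<close>-manifold,
  and invariance of domain gives \<open>m \<le> i\<close>. The same argument (lemma \<open>Euclidean_axis_dichotomy\<close>)
  proves the finiteness of the index by induction on the dimension.
\<close>

section \<open>Open embeddings\<close>

text \<open>
  Neighbourhoods of the form \<open>\<real>\<^sup>m \<times> cL\<close> are handled as open embeddings of \<open>\<real>\<^sup>m \<times> cL\<close>: these compose
  and multiply without any mention of subspaces.
\<close>

definition open_embedding :: "'a topology \<Rightarrow> 'b topology \<Rightarrow> ('a \<Rightarrow> 'b) \<Rightarrow> bool"
  where "open_embedding X Y f \<longleftrightarrow> continuous_map X Y f \<and> open_map X Y f \<and> inj_on f (topspace X)"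

lemma open_embedding_image: "open_embedding X Y f \<Longrightarrow> openin Y (f ` topspace X)"
  by (simp add: open_embedding_def open_map_def)

lemma open_embedding_in_topspace: "\<lbrakk>open_embedding X Y f; x \<in> topspace X\<rbrakk> \<Longrightarrow> f x \<in> topspace Y"
  by (auto simp: open_embedding_def continuous_map_def)

lemma open_embedding_compose:
  assumes "open_embedding X Y f" "open_embedding Y Z g"
  shows "open_embedding X Z (g \<circ> f)"
  using assms unfolding open_embedding_def
  by (meson comp_inj_on continuous_map_compose continuous_map_image_subset_topspace inj_on_subset
      open_map_compose)

lemma open_embedding_eq_embedding_map:
  "open_embedding X Y f \<longleftrightarrow> embedding_map X Y f \<and> openin Y (f ` topspace X)"
proof
  assume *: "open_embedding X Y f"
  then show "embedding_map X Y f \<and> openin Y (f ` topspace X)"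
    by (meson injective_open_imp_embedding_map open_embedding_def open_map_def openin_topspace)
next
  assume *: "embedding_map X Y f \<and> openin Y (f ` topspace X)"
  then have "homeomorphic_map X (subtopology Y (f ` topspace X)) f"
    by (simp add: embedding_map_def)
  moreover from this have "open_map X Y f"
    using * by (metis homeomorphic_imp_open_map open_map_def openin_open_subtopology)
  ultimately show "open_embedding X Y f"
    unfolding open_embedding_def homeomorphic_eq_everything_map
    by (meson continuous_map_in_subtopology)
qed

lemma homeomorphic_map_imp_open_embedding: "homeomorphic_map X Y f \<Longrightarrow> open_embedding X Y f"
  by (simp add: open_embedding_def homeomorphic_eq_everything_map)

lemma homeomorphic_maps_imp_open_embedding: "homeomorphic_maps X Y f g \<Longrightarrow> open_embedding X Y f"
  by (metis homeomorphic_map_imp_open_embedding homeomorphic_map_maps)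

lemma open_embedding_restrict_codomain:
  assumes "open_embedding X (subtopology Y U) f" "openin Y U"
  shows "open_embedding X Y f"
  using assms unfolding open_embedding_def open_map_def
  by (meson continuous_map_in_subtopology openin_open_subtopology)

lemma open_embedding_inverse:
  assumes "open_embedding X Y f"
  obtains g where "homeomorphic_maps X (subtopology Y (f ` topspace X)) f g"
  using assms unfolding open_embedding_eq_embedding_map embedding_map_def homeomorphic_map_maps
  by blast

text \<open>
  This is what makes indices local: a neighbourhood in \<open>Y\<close> that lies in the image of \<open>X\<close> is a
  neighbourhood in \<open>X\<close>.
\<close>

lemma open_embedding_lift:
  assumes f: "open_embedding X Y f" and e: "open_embedding Z Y e"
    and sub: "e ` topspace Z \<subseteq> f ` topspace X"
  obtains e' where "open_embedding Z X e'" "\<And>z. z \<in> topspace Z \<Longrightarrow> f (e' z) = e z"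
proof -
  obtain g where g: "homeomorphic_maps X (subtopology Y (f ` topspace X)) f g"
    using open_embedding_inverse[OF f] .
  have fg: "f (g (e z)) = e z" if "z \<in> topspace Z" for z
    using g sub that open_embedding_in_topspace[OF f]
    by (auto simp: homeomorphic_maps_def image_subset_iff)
  have "continuous_map Z (subtopology Y (f ` topspace X)) e"
    using e sub by (auto simp: open_embedding_def continuous_map_in_subtopology)
  then have cont: "continuous_map Z X (g \<circ> e)"
    using g by (meson continuous_map_compose homeomorphic_maps_def)
  moreover have "open_map Z X (g \<circ> e)"
  proof (rule open_map_from_composition_right)
    show "open_map Z Y (f \<circ> (g \<circ> e))"
      unfolding open_map_def
    proof (intro allI impI)
      fix W assume W: "openin Z W"
      then have "(f \<circ> (g \<circ> e)) ` W = e ` W"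
        using fg openin_subset by (intro image_cong) fastforce+
      then show "openin Y ((f \<circ> (g \<circ> e)) ` W)"
        using e W by (simp add: open_embedding_def open_map_def)
    qed
    show "g \<circ> e \<in> topspace Z \<rightarrow> topspace X"
      using cont continuous_map_funspace by blast
  qed (use f in \<open>auto simp: open_embedding_def\<close>)
  moreover have "inj_on (g \<circ> e) (topspace Z)"
    using e fg unfolding open_embedding_def inj_on_def by (metis comp_apply)
  ultimately show thesis
    using that[of "g \<circ> e"] fg by (simp add: open_embedding_def)
qed

lemma open_embedding_prod:
  assumes f: "open_embedding X X' f" and g: "open_embedding Y Y' g"
  shows "open_embedding (prod_topology X Y) (prod_topology X' Y') (map_prod f g)"
  unfolding open_embedding_def
proof (intro conjI)
  show "continuous_map (prod_topology X Y) (prod_topology X' Y') (map_prod f g)"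
    using f g unfolding open_embedding_def continuous_map_pairwise
    by (auto simp: comp_def intro: continuous_map_compose[OF continuous_map_fst, unfolded comp_def]
        continuous_map_compose[OF continuous_map_snd, unfolded comp_def])
  show "inj_on (map_prod f g) (topspace (prod_topology X Y))"
    using f g by (auto simp: open_embedding_def intro: map_prod_inj_on)
  show "open_map (prod_topology X Y) (prod_topology X' Y') (map_prod f g)"
    unfolding open_map_def
  proof (intro allI impI)
    fix W assume W: "openin (prod_topology X Y) W"
    show "openin (prod_topology X' Y') (map_prod f g ` W)"
      unfolding openin_prod_topology_alt
    proof (intro allI impI)
      fix x' y' assume "(x', y') \<in> map_prod f g ` W"
      then obtain x y where xy: "(x, y) \<in> W" "x' = f x" "y' = g y" by auto
      then obtain U V where "openin X U" "openin Y V" "x \<in> U" "y \<in> V" "U \<times> V \<subseteq> W"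
        using W unfolding openin_prod_topology_alt by meson
      then show "\<exists>U V. openin X' U \<and> openin Y' V \<and> x' \<in> U \<and> y' \<in> V \<and> U \<times> V \<subseteq> map_prod f g ` W"
        using f g xy unfolding open_embedding_def open_map_def
        by (intro exI[of _ "f ` U"] exI[of _ "g ` V"]) (auto simp: image_iff; force)
    qed
  qed
qed

lemma open_embedding_id: "open_embedding X X id"
  by (simp add: open_embedding_def open_map_id)

section \<open>Maps of cones\<close>

lemma continuous_map_cone_proj:
  "continuous_map (prod_topology L (top_of_set {0..})) (open_cone L) cone_proj"
  by (cases "topspace L = {}")
    (auto simp: continuous_map_def openin_open_cone topspace_open_cone cone_set_def
      quotient_imp_continuous_map[OF quotient_map_cone_proj])

lemma cone_vertex_in_topspace [simp]: "cone_vertex \<in> topspace (open_cone L)"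
  by (simp add: topspace_open_cone cone_set_def)

lemma Some_in_cone_set [simp]: "Some (y, t) \<in> cone_set A \<longleftrightarrow> y \<in> A \<and> t > 0"
  by (auto simp: cone_set_def cone_proj_def cone_vertex_def image_iff split: if_splits)

lemma cone_set_cases:
  assumes "c \<in> cone_set A"
  obtains "c = cone_vertex" | y t where "c = Some (y, t)" "y \<in> A" "t > 0"
  using assms by (fastforce simp: cone_set_def cone_proj_def split: if_splits)

lemma half_line_subset: "{0::real<..} \<subseteq> {0..}"
  by auto

text \<open>
  Sets that avoid radius 0 are saturated for the quotient map onto the cone, so open ones among them
  have open image.
\<close>

lemma open_embedding_cone_proj:
  "open_embedding (prod_topology L (top_of_set {0<..})) (open_cone L) cone_proj"
proof -
  have "continuous_map (prod_topology L (top_of_set {0<..})) (open_cone L) cone_proj"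
    using continuous_map_from_subtopology[OF continuous_map_cone_proj, of L "topspace L \<times> {0<..}"]
    by (simp add: subtopology_Times subtopology_subtopology Int_absorb1 half_line_subset)
  moreover have "open_map (prod_topology L (top_of_set {0<..})) (open_cone L) cone_proj"
    unfolding open_map_def
  proof (intro allI impI)
    fix W assume W: "openin (prod_topology L (top_of_set {0::real<..})) W"
    then have sub: "W \<subseteq> topspace L \<times> {0<..}"
      using openin_subset by fastforce
    have eq: "prod_topology L (top_of_set {0<..}) =
        subtopology (prod_topology L (top_of_set {0..})) (topspace L \<times> {0::real<..})"
      by (simp add: subtopology_Times subtopology_subtopology Int_absorb1 half_line_subset)
    have "openin (top_of_set {0..}) {0::real<..}"
      by (simp add: open_subset half_line_subset)
    then have "openin (prod_topology L (top_of_set {0..})) W"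
      using W unfolding eq
      by (subst (asm) openin_open_subtopology) (auto simp: openin_prod_Times_iff)
    moreover have "{z \<in> topspace L \<times> {0..}. cone_proj z \<in> cone_proj ` W} = W"
      using sub by (auto simp: cone_proj_def cone_vertex_def split: if_splits)
    moreover have "cone_proj ` W \<subseteq> cone_set (topspace L)"
      using sub by (auto simp: cone_proj_def)
    ultimately show "openin (open_cone L) (cone_proj ` W)"
      by (simp add: openin_open_cone)
  qed
  moreover have "inj_on cone_proj (topspace (prod_topology L (top_of_set {0<..})))"
    by (auto simp: inj_on_def cone_proj_def)
  ultimately show ?thesis by (simp add: open_embedding_def)
qed

lemma open_embedding_swap: "open_embedding (prod_topology X Y) (prod_topology Y X) prod.swap"
proof -
  have "homeomorphic_maps (prod_topology X Y) (prod_topology Y X) prod.swap prod.swap"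
    by (auto simp: homeomorphic_maps_def prod.swap_def continuous_map_pairwise comp_def
        continuous_map_fst[unfolded comp_def] continuous_map_snd[unfolded comp_def] intro: continuous_intros)
  then show ?thesis by (rule homeomorphic_maps_imp_open_embedding)
qed

text \<open>
  The logarithm of the radius identifies the cone without its vertex with \<open>\<real> \<times> L\<close>.
\<close>

lemma open_embedding_log_polar:
  "open_embedding (prod_topology euclideanreal L) (open_cone L) (\<lambda>(s, y). Some (y, exp s))"
proof -
  have "homeomorphic_maps euclideanreal (top_of_set {0<..}) (exp :: real \<Rightarrow> real) ln"
    by (auto simp: homeomorphic_maps_def continuous_map_in_subtopology intro!: continuous_intros)
  then have "open_embedding euclideanreal (top_of_set {0<..}) (exp :: real \<Rightarrow> real)"
    by (rule homeomorphic_maps_imp_open_embedding)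
  then have "open_embedding (prod_topology euclideanreal L) (open_cone L)
      (cone_proj \<circ> (map_prod id exp \<circ> prod.swap))"
    by (intro open_embedding_compose[OF _ open_embedding_cone_proj]
        open_embedding_compose[OF open_embedding_swap] open_embedding_prod open_embedding_id)
  also have "cone_proj \<circ> (map_prod id exp \<circ> prod.swap) = (\<lambda>(s, y). Some (y, exp s))"
    by (auto simp: fun_eq_iff cone_proj_def)
  finally show ?thesis .
qed

definition cone_radial_map :: "(real \<Rightarrow> real) \<Rightarrow> 'a cone \<Rightarrow> 'a cone"
  where "cone_radial_map \<phi> = map_option (map_prod id \<phi>)"

lemma cone_radial_map_vertex [simp]: "cone_radial_map \<phi> cone_vertex = cone_vertex"
  by (simp add: cone_radial_map_def cone_vertex_def)

text \<open>
  Preimages and images under the radial map correspond, in \<open>L \<times> [0, \<infinity>)\<close>, to preimages and images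
  under \<open>id \<times> \<phi>\<close>; so openness can be tested before passing to the quotient.
\<close>

lemma open_embedding_cone_radial_map:
  assumes \<phi>: "open_embedding (top_of_set {0..}) (top_of_set {0..}) \<phi>" and "\<phi> 0 = 0"
  shows "open_embedding (open_cone L) (open_cone L) (cone_radial_map \<phi>)"
proof -
  let ?P = "prod_topology L (top_of_set {0::real..})" and ?Z = "topspace L \<times> {0::real..}"
  let ?r = "cone_radial_map \<phi> :: 'a cone \<Rightarrow> 'a cone"
  have pos: "\<phi> t > 0" if "t > 0" for t
  proof -
    have "\<phi> t \<ge> 0" using open_embedding_in_topspace[OF \<phi>, of t] that by simp
    moreover have "\<phi> t \<noteq> \<phi> 0"
      using \<phi> that by (auto simp: open_embedding_def inj_on_def)
    ultimately show ?thesis using assms(2) by simp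
  qed
  have emb: "open_embedding ?P ?P (map_prod id \<phi>)"
    by (intro open_embedding_prod open_embedding_id \<phi>)
  have r: "?r (cone_proj z) = cone_proj (map_prod id \<phi> z)" if "z \<in> ?Z" for z
    using that pos[of "snd z"] assms(2)
    by (cases "snd z = 0") (auto simp: cone_radial_map_def cone_proj_def cone_vertex_def)
  have maps: "?r c \<in> cone_set (topspace L)" if "c \<in> cone_set (topspace L)" for c
    using that
  proof (cases rule: cone_set_cases)
    case 1
    then show ?thesis by (simp add: cone_set_def)
  qed (simp add: cone_radial_map_def pos)
  have inj: "inj_on ?r (topspace (open_cone L))"
  proof (rule inj_onI)
    fix c d assume cd: "c \<in> topspace (open_cone L)" "d \<in> topspace (open_cone L)" "?r c = ?r d"
    have "inj_on \<phi> {0..}" using \<phi> by (simp add: open_embedding_def)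
    with cd show "c = d"
      unfolding topspace_open_cone
      by (auto elim!: cone_set_cases simp: cone_radial_map_def cone_vertex_def inj_on_def)
  qed
  have "continuous_map (open_cone L) (open_cone L) ?r"
    unfolding continuous_map_def
  proof (intro conjI allI impI)
    show "?r \<in> topspace (open_cone L) \<rightarrow> topspace (open_cone L)"
      using maps by (simp add: topspace_open_cone)
    fix W assume W: "openin (open_cone L) W"
    have "{z \<in> ?Z. cone_proj z \<in> {c \<in> topspace (open_cone L). ?r c \<in> W}} =
        {z \<in> topspace ?P. map_prod id \<phi> z \<in> {z \<in> ?Z. cone_proj z \<in> W}}"
    proof (rule Collect_cong)
      fix z
      have "cone_proj z \<in> topspace (open_cone L)" "map_prod id \<phi> z \<in> ?Z" if "z \<in> ?Z"
        using that open_embedding_in_topspace[OF emb, of z] by (auto simp: topspace_open_cone cone_set_def)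
      then show "z \<in> ?Z \<and> cone_proj z \<in> {c \<in> topspace (open_cone L). ?r c \<in> W} \<longleftrightarrow>
          z \<in> topspace ?P \<and> map_prod id \<phi> z \<in> {z \<in> ?Z. cone_proj z \<in> W}"
        using r[of z] by (cases "z \<in> ?Z") simp_all
    qed
    moreover have "openin ?P {z \<in> topspace ?P. map_prod id \<phi> z \<in> {z \<in> ?Z. cone_proj z \<in> W}}"
      using W emb by (intro openin_continuous_map_preimage[of _ ?P]) (auto simp: openin_open_cone open_embedding_def)
    ultimately show "openin (open_cone L) {c \<in> topspace (open_cone L). ?r c \<in> W}"
      by (auto simp: openin_open_cone topspace_open_cone)
  qed
  moreover have "open_map (open_cone L) (open_cone L) ?r"
    unfolding open_map_def
  proof (intro allI impI)
    fix W assume W: "openin (open_cone L) W"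
    let ?W = "{z \<in> ?Z. cone_proj z \<in> W}"
    have sub: "W \<subseteq> cone_set (topspace L)" using W by (simp add: openin_open_cone)
    have "{z \<in> ?Z. cone_proj z \<in> ?r ` W} = map_prod id \<phi> ` ?W"
    proof (intro equalityI subsetI)
      fix z assume "z \<in> {z \<in> ?Z. cone_proj z \<in> ?r ` W}"
      then obtain c where c: "z \<in> ?Z" "c \<in> W" "cone_proj z = ?r c" by auto
      obtain y s where ys: "z = (y, s)" by fastforce
      from c(2) sub have "c \<in> cone_set (topspace L)" by auto
      then show "z \<in> map_prod id \<phi> ` ?W"
      proof (cases rule: cone_set_cases)
        case 1
        then have "cone_proj (y, s) = cone_vertex" using c ys by simp
        then have "s = 0" by (auto simp: cone_proj_def cone_vertex_def split: if_splits)
        with 1 c ys show ?thesis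
          by (intro image_eqI[of _ _ "(y, 0)"]) (auto simp: assms(2) cone_proj_def)
      next
        case (2 x t)
        then have "z = (x, \<phi> t)" using c ys
          by (auto simp: cone_proj_def cone_vertex_def cone_radial_map_def split: if_splits)
        with 2 c ys show ?thesis
          by (intro image_eqI[of _ _ "(x, t)"]) (auto simp: cone_proj_def)
      qed
    next
      fix z assume "z \<in> map_prod id \<phi> ` ?W"
      then obtain w where w: "w \<in> ?W" "z = map_prod id \<phi> w" by auto
      then have "z \<in> ?Z" using open_embedding_in_topspace[OF emb, of w] by auto
      moreover have "cone_proj z = ?r (cone_proj w)" using r w by auto
      ultimately show "z \<in> {z \<in> ?Z. cone_proj z \<in> ?r ` W}" using w by auto
    qed
    moreover have "openin ?P (map_prod id \<phi> ` ?W)"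
      using W emb by (auto simp: openin_open_cone open_embedding_def open_map_def)
    ultimately show "openin (open_cone L) (?r ` W)"
      using sub maps by (auto simp: openin_open_cone)
  qed
  ultimately show ?thesis using inj by (simp add: open_embedding_def)
qed

text \<open>
  By compactness of \<open>L\<close> (tube lemma), a neighbourhood of the vertex contains all points of
  radius less than some \<open>\<epsilon>\<close>. Shrinking the radius to \<open>[0, \<epsilon>)\<close> pushes the whole cone into it.
\<close>

lemma cone_compression:
  assumes L: "compact_space L" and W: "openin (open_cone L) W" "cone_vertex \<in> W"
  obtains f where "open_embedding (open_cone L) (open_cone L) f" "f cone_vertex = cone_vertex"
    "f ` topspace (open_cone L) \<subseteq> W"
proof -
  let ?P = "prod_topology L (top_of_set {0::real..})" and ?Z = "topspace L \<times> {0::real..}"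
  let ?W = "{z \<in> ?Z. cone_proj z \<in> W}"
  have "openin ?P ?W" "topspace L \<times> {0} \<subseteq> ?W"
    using W by (auto simp: openin_open_cone cone_proj_def)
  then obtain U T where UT: "topspace L \<subseteq> U" "openin (top_of_set {0::real..}) T" "0 \<in> T" "U \<times> T \<subseteq> ?W"
    using tube_lemma_left[of L "top_of_set {0::real..}" ?W "topspace L" 0] L
    by (auto simp: compact_space_def)
  obtain \<epsilon> where \<epsilon>: "\<epsilon> > 0" "ball 0 \<epsilon> \<inter> {0..} \<subseteq> T"
    using UT(2,3) unfolding openin_contains_ball by blast
  \<comment> \<open>\<open>\<phi>\<close> maps \<open>[0, \<infinity>)\<close> homeomorphically onto \<open>[0, \<epsilon>)\<close>, with inverse \<open>\<psi>\<close>.\<close>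
  define \<phi> where "\<phi> t = \<epsilon> * t / (1 + t)" for t :: real
  define \<psi> where "\<psi> s = s / (\<epsilon> - s)" for s :: real
  have "homeomorphic_maps (top_of_set {0..}) (top_of_set {0..<\<epsilon>}) \<phi> \<psi>"
    using \<epsilon>(1) unfolding homeomorphic_maps_def \<phi>_def \<psi>_def
    by (auto simp: continuous_map_in_subtopology divide_simps intro!: continuous_intros)
      (auto simp: algebra_simps)
  moreover have "openin (top_of_set {0..}) {0..<\<epsilon>}"
    by (auto simp: openin_open intro!: exI[of _ "{..<\<epsilon>}"])
  ultimately have \<phi>: "open_embedding (top_of_set {0..}) (top_of_set {0..}) \<phi>"
    using open_embedding_restrict_codomain[of _ "top_of_set {0..}" "{0..<\<epsilon>}"]
      homeomorphic_maps_imp_open_embedding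
    by (metis (no_types, lifting) atLeastLessThan_iff atLeast_iff subsetI subtopology_subtopology Int_absorb1)
  have lt: "\<phi> t \<in> T" if "t \<ge> 0" for t
    using that \<epsilon> by (intro subsetD[OF \<epsilon>(2)]) (auto simp: \<phi>_def divide_simps algebra_simps)
  show thesis
  proof
    show "open_embedding (open_cone L) (open_cone L) (cone_radial_map \<phi>)"
      by (rule open_embedding_cone_radial_map[OF \<phi>]) (simp add: \<phi>_def)
    show "cone_radial_map \<phi> ` topspace (open_cone L) \<subseteq> W"
    proof clarify
      fix c assume c: "c \<in> topspace (open_cone L)"
      then have "c \<in> cone_set (topspace L)" by (simp add: topspace_open_cone)
      then show "cone_radial_map \<phi> c \<in> W"
      proof (cases rule: cone_set_cases)
        case 1
        then show ?thesis using W by simp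
      next
        case (2 y t)
        then have "(y, \<phi> t) \<in> ?W" using lt[of t] UT by auto
        moreover have "\<phi> t > 0" using 2 \<epsilon> by (simp add: \<phi>_def)
        ultimately show ?thesis using 2 by (simp add: cone_radial_map_def cone_proj_def)
      qed
    qed
  qed simp
qed

section \<open>Products of a Euclidean space and a cone\<close>

abbreviation Euclidean_cone :: "nat \<Rightarrow> 'a topology \<Rightarrow> ((nat \<Rightarrow> real) \<times> 'a cone) topology"
  where "Euclidean_cone m L \<equiv> prod_topology (Euclidean_space m) (open_cone L)"

abbreviation Euclidean_cone_origin :: "(nat \<Rightarrow> real) \<times> 'a cone"
  where "Euclidean_cone_origin \<equiv> (\<lambda>_. 0, cone_vertex)"

lemma zero_in_Euclidean_space [simp]: "(\<lambda>_. 0) \<in> topspace (Euclidean_space m)"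
  by (simp add: topspace_Euclidean_space)

lemma continuous_map_Euclidean_component: "continuous_map (Euclidean_space m) euclideanreal (\<lambda>x. x i)"
  unfolding Euclidean_space_def
  by (intro continuous_map_from_subtopology continuous_map_product_projection) simp

lemma Euclidean_space_cube_nbhd:
  assumes "openin (Euclidean_space m) A" "(\<lambda>_. 0) \<in> A"
  obtains \<epsilon> :: real where "\<epsilon> > 0"
    "\<And>x. \<lbrakk>x \<in> topspace (Euclidean_space m); \<And>i. \<bar>x i\<bar> < \<epsilon>\<rbrakk> \<Longrightarrow> x \<in> A"
proof -
  obtain B where B: "openin (powertop_real UNIV) B" "A = B \<inter> {x. \<forall>i\<ge>m. x i = 0}"
    using assms(1) by (auto simp: Euclidean_space_def openin_subtopology)
  then obtain U where U: "finite {i. U i \<noteq> UNIV}" "\<And>i. open (U i)" "(\<lambda>_. 0) \<in> Pi\<^sub>E UNIV U"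
      "Pi\<^sub>E UNIV U \<subseteq> B"
    using assms(2) by (fastforce simp: openin_product_topology_alt)
  have "\<exists>e>0. ball 0 e \<subseteq> U i" for i
    using openE[OF U(2)[of i], of 0] U(3) by blast
  then obtain e where e: "\<And>i. e i > 0" "\<And>i. ball 0 (e i) \<subseteq> U i" by metis
  \<comment> \<open>The \<open>1\<close> covers the case that no coordinate is restricted.\<close>
  define \<epsilon> where "\<epsilon> = Min (insert 1 (e ` {i. U i \<noteq> UNIV}))"
  show thesis
  proof
    show "\<epsilon> > 0" using U(1) e by (auto simp: \<epsilon>_def)
    fix x assume x: "x \<in> topspace (Euclidean_space m)" "\<And>i. \<bar>x i\<bar> < \<epsilon>"
    have "x i \<in> U i" for i
    proof (cases "U i = UNIV")
      case False
      then have "\<epsilon> \<le> e i" using U(1) by (simp add: \<epsilon>_def)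
      then show ?thesis using x(2)[of i] e(2)[of i] by auto
    qed simp
    then show "x \<in> A" using U(4) B x(1) by (auto simp: topspace_Euclidean_space)
  qed
qed

text \<open>
  The coordinatewise squeezing \<open>t \<mapsto> \<epsilon> t / (1 + |t|)\<close> is continuous and injective; that it is open
  is a cheap consequence of invariance of domain.
\<close>

lemma Euclidean_space_compression:
  assumes "openin (Euclidean_space m) A" "(\<lambda>_. 0) \<in> A"
  obtains f where "open_embedding (Euclidean_space m) (Euclidean_space m) f" "f (\<lambda>_. 0) = (\<lambda>_. 0)"
    "f ` topspace (Euclidean_space m) \<subseteq> A"
proof -
  obtain \<epsilon> :: real where \<epsilon>: "\<epsilon> > 0"
    "\<And>x. \<lbrakk>x \<in> topspace (Euclidean_space m); \<And>i. \<bar>x i\<bar> < \<epsilon>\<rbrakk> \<Longrightarrow> x \<in> A"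
    using Euclidean_space_cube_nbhd[OF assms] by blast
  define f where "f x i = (if i < m then \<epsilon> * x i / (1 + \<bar>x i\<bar>) else 0)" for x :: "nat \<Rightarrow> real" and i
  have cont: "continuous_map (Euclidean_space m) (Euclidean_space m) f"
    unfolding f_def continuous_map_componentwise_Euclidean_space
    by (auto intro!: continuous_intros continuous_map_Euclidean_component)
  have inj1: "a = b" if "\<epsilon> * a / (1 + \<bar>a\<bar>) = \<epsilon> * b / (1 + \<bar>b\<bar>)" for a b :: real
  proof -
    have nz: "1 + \<bar>a\<bar> \<noteq> 0" "1 + \<bar>b\<bar> \<noteq> 0" by linarith+
    have "\<epsilon> * (a * (1 + \<bar>b\<bar>)) = \<epsilon> * (b * (1 + \<bar>a\<bar>))"
      using that unfolding frac_eq_eq[OF nz] by (simp only: mult.assoc)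
    then have eq: "a * (1 + \<bar>b\<bar>) = b * (1 + \<bar>a\<bar>)" using \<epsilon>(1) by simp
    then have "a \<ge> 0 \<longleftrightarrow> b \<ge> 0"
      by (smt (verit) zero_le_mult_iff)
    with eq show ?thesis
      by (cases "a \<ge> 0") (auto simp: algebra_simps)
  qed
  have inj: "inj_on f (topspace (Euclidean_space m))"
  proof (intro inj_onI ext)
    fix x y i assume xy: "x \<in> topspace (Euclidean_space m)" "y \<in> topspace (Euclidean_space m)" "f x = f y"
    have "f x i = f y i" using xy(3) by simp
    then show "x i = y i"
      using xy(1,2) inj1[of "x i" "y i"]
      by (cases "i < m") (auto simp: f_def topspace_Euclidean_space)
  qed
  have "open_map (Euclidean_space m) (Euclidean_space m) f"
    unfolding open_map_def
    using invariance_of_domain_Euclidean_space continuous_map_from_subtopology[OF cont] inj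
    by (meson inj_on_subset openin_subset)
  with cont inj have "open_embedding (Euclidean_space m) (Euclidean_space m) f"
    by (simp add: open_embedding_def)
  moreover have "\<bar>f x i\<bar> < \<epsilon>" for x i
  proof -
    have "\<epsilon> * \<bar>x i\<bar> < \<epsilon> * (1 + \<bar>x i\<bar>)" using \<epsilon>(1) by simp
    then show ?thesis using \<epsilon>(1) by (auto simp: f_def abs_mult divide_simps)
  qed
  then have "f ` topspace (Euclidean_space m) \<subseteq> A"
    using \<epsilon>(2) by (auto simp: topspace_Euclidean_space f_def)
  moreover have "f (\<lambda>_. 0) = (\<lambda>_. 0)" by (simp add: f_def fun_eq_iff)
  ultimately show thesis using that[of f] by blast
qed

text \<open>
  Arbitrarily small neighbourhoods of the origin of \<open>\<real>\<^sup>m \<times> cL\<close> look like all of \<open>\<real>\<^sup>m \<times> cL\<close>. This allows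
  neighbourhoods to be taken open and inside any given open set.
\<close>

lemma Euclidean_cone_compression:
  assumes L: "compact_space L"
    and W: "openin (Euclidean_cone m L) W" "Euclidean_cone_origin \<in> W"
  obtains f where "open_embedding (Euclidean_cone m L) (Euclidean_cone m L) f"
    "f Euclidean_cone_origin = Euclidean_cone_origin" "f ` topspace (Euclidean_cone m L) \<subseteq> W"
proof -
  obtain A B where AB: "openin (Euclidean_space m) A" "openin (open_cone L) B"
      "(\<lambda>_. 0) \<in> A" "cone_vertex \<in> B" "A \<times> B \<subseteq> W"
    using W unfolding openin_prod_topology_alt by meson
  obtain f where f: "open_embedding (Euclidean_space m) (Euclidean_space m) f" "f (\<lambda>_. 0) = (\<lambda>_. 0)"
    "f ` topspace (Euclidean_space m) \<subseteq> A"
    using Euclidean_space_compression[OF AB(1,3)] .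
  obtain g where g: "open_embedding (open_cone L) (open_cone L) g" "g cone_vertex = cone_vertex"
    "g ` topspace (open_cone L) \<subseteq> B"
    using cone_compression[OF L AB(2,4)] .
  show thesis
  proof
    show "open_embedding (Euclidean_cone m L) (Euclidean_cone m L) (map_prod f g)"
      by (intro open_embedding_prod f g)
    show "map_prod f g ` topspace (Euclidean_cone m L) \<subseteq> W"
      using f(3) g(3) AB(5) by auto
  qed (simp add: f g)
qed

lemma continuous_map_prod_components [simp]:
  "continuous_map (prod_topology X Y) X (\<lambda>z. fst z)" "continuous_map (prod_topology X Y) Y (\<lambda>z. snd z)"
  using continuous_map_fst[of X Y] continuous_map_snd[of X Y] by (simp_all add: eta_contract_eq)

lemma open_embedding_Euclidean_translation:
  assumes a: "a \<in> topspace (Euclidean_space m)"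
  shows "open_embedding (prod_topology (Euclidean_space m) Y) (prod_topology (Euclidean_space m) Y)
    (\<lambda>(v, y). (\<lambda>i. v i + a i, y))"
proof -
  have cont: "continuous_map (Euclidean_space m) (Euclidean_space m) (\<lambda>v i. v i + a i)"
      "continuous_map (Euclidean_space m) (Euclidean_space m) (\<lambda>v i. v i - a i)"
    using a by (auto intro!: continuous_map_Euclidean_space_add continuous_map_Euclidean_space_diff)
  then have "homeomorphic_maps (Euclidean_space m) (Euclidean_space m) (\<lambda>v i. v i + a i) (\<lambda>v i. v i - a i)"
    by (simp add: homeomorphic_maps_def)
  then have "open_embedding (Euclidean_space m) (Euclidean_space m) (\<lambda>v i. v i + a i)"
    by (rule homeomorphic_maps_imp_open_embedding)
  from open_embedding_prod[OF this open_embedding_id, of Y]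
  show ?thesis by (simp add: map_prod_def)
qed

lemma open_embedding_Euclidean_split:
  "open_embedding (Euclidean_space (Suc m)) (prod_topology (Euclidean_space m) euclideanreal)
    (\<lambda>u. (\<lambda>i. if i < m then u i else 0, u m))"
proof -
  have "continuous_map (Euclidean_space (Suc m)) (prod_topology (Euclidean_space m) euclideanreal)
      (\<lambda>u. (\<lambda>i. if i < m then u i else 0, u m))"
    by (auto simp: continuous_map_pairwise comp_def continuous_map_componentwise_Euclidean_space
        continuous_map_Euclidean_component)
  moreover have "continuous_map (prod_topology (Euclidean_space m) euclideanreal) (Euclidean_space (Suc m))
      (\<lambda>z i. if i < Suc m then if i < m then fst z i else snd z else 0)"
    unfolding continuous_map_componentwise_Euclidean_space
  proof (intro allI impI)
    fix i
    have "continuous_map (prod_topology (Euclidean_space m) euclideanreal) euclideanreal (\<lambda>z. fst z i)"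
      using continuous_map_compose[OF continuous_map_fst continuous_map_Euclidean_component]
      by (simp add: comp_def)
    then show "continuous_map (prod_topology (Euclidean_space m) euclideanreal) euclideanreal
        (\<lambda>z. if i < m then fst z i else snd z)"
      by simp
  qed
  ultimately have "homeomorphic_maps (Euclidean_space (Suc m)) (prod_topology (Euclidean_space m) euclideanreal)
      (\<lambda>u. (\<lambda>i. if i < m then u i else 0, u m))
      (\<lambda>z i. if i < Suc m then if i < m then fst z i else snd z else 0)"
    by (auto simp: homeomorphic_maps_def topspace_Euclidean_space fun_eq_iff less_Suc_eq)
  then show ?thesis by (rule homeomorphic_maps_imp_open_embedding)
qed

lemma open_embedding_assoc:
  "open_embedding (prod_topology (prod_topology X Y) Z) (prod_topology X (prod_topology Y Z))
    (\<lambda>((x, y), z). (x, (y, z)))"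
proof -
  have "continuous_map (prod_topology (prod_topology X Y) Z) X (\<lambda>z. fst (fst z))"
       "continuous_map (prod_topology (prod_topology X Y) Z) Y (\<lambda>z. snd (fst z))"
       "continuous_map (prod_topology X (prod_topology Y Z)) Y (\<lambda>z. fst (snd z))"
       "continuous_map (prod_topology X (prod_topology Y Z)) Z (\<lambda>z. snd (snd z))"
    using continuous_map_compose[OF continuous_map_fst continuous_map_fst]
      continuous_map_compose[OF continuous_map_fst continuous_map_snd]
      continuous_map_compose[OF continuous_map_snd continuous_map_fst]
      continuous_map_compose[OF continuous_map_snd continuous_map_snd]
    by (simp_all add: comp_def)
  then have "homeomorphic_maps (prod_topology (prod_topology X Y) Z) (prod_topology X (prod_topology Y Z))
    (\<lambda>((x, y), z). (x, (y, z))) (\<lambda>(x, (y, z)). ((x, y), z))"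
    by (auto simp: homeomorphic_maps_def continuous_map_pairwise comp_def case_prod_unfold)
  then show ?thesis by (rule homeomorphic_maps_imp_open_embedding)
qed

text \<open>
  The last coordinate of \<open>u\<close> is the logarithm of the radius; the others are the point of \<open>\<real>\<^sup>m\<close>.
\<close>

definition punctured_cone_map :: "nat \<Rightarrow> (nat \<Rightarrow> real) \<times> 'a \<Rightarrow> (nat \<Rightarrow> real) \<times> 'a cone"
  where "punctured_cone_map m = (\<lambda>(u, y). (\<lambda>i. if i < m then u i else 0, Some (y, exp (u m))))"

lemma open_embedding_punctured_cone_map:
  "open_embedding (prod_topology (Euclidean_space (Suc m)) L) (Euclidean_cone m L) (punctured_cone_map m)"
proof -
  have eq: "punctured_cone_map m = map_prod id (\<lambda>(s, y). Some (y, exp s)) \<circ> ((\<lambda>((x, y), z). (x, (y, z))) \<circ>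
      map_prod (\<lambda>u. (\<lambda>i. if i < m then u i else 0, u m)) id)"
    by (auto simp: punctured_cone_map_def fun_eq_iff)
  show ?thesis
    unfolding eq
    by (rule open_embedding_compose[OF open_embedding_compose[OF
          open_embedding_prod[OF open_embedding_Euclidean_split open_embedding_id] open_embedding_assoc]
          open_embedding_prod[OF open_embedding_id open_embedding_log_polar]])
qed

lemma Euclidean_cone_cases:
  assumes "z \<in> topspace (Euclidean_cone m L)"
  obtains v where "v \<in> topspace (Euclidean_space m)" "z = (v, cone_vertex)"
  | u y where "u \<in> topspace (Euclidean_space (Suc m))" "y \<in> topspace L" "z = punctured_cone_map m (u, y)"
proof -
  obtain v c where z: "z = (v, c)" "v \<in> topspace (Euclidean_space m)" "c \<in> cone_set (topspace L)"
    using assms by (auto simp: topspace_open_cone)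
  from z(3) show thesis
  proof (cases rule: cone_set_cases)
    case 1
    with z that(1) show ?thesis by blast
  next
    case (2 y t)
    show ?thesis
    proof (rule that(2))
      show "v(m := ln t) \<in> topspace (Euclidean_space (Suc m))"
        using z(2) by (auto simp: topspace_Euclidean_space)
      show "z = punctured_cone_map m (v(m := ln t), y)"
        using z 2 by (auto simp: punctured_cone_map_def fun_eq_iff topspace_Euclidean_space)
    qed (fact 2)
  qed
qed

lemma punctured_cone_map_not_vertex [simp]: "snd (punctured_cone_map m z) \<noteq> cone_vertex"
  by (simp add: punctured_cone_map_def cone_vertex_def case_prod_unfold)

section \<open>Conical neighbourhoods as open embeddings\<close>

text \<open>
  The given neighbourhood \<open>U\<close> need not be open. Compressing the model into the image of the part of
  the interior of \<open>U\<close> that lies in \<open>W\<close> makes it open and small at the same time.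
\<close>

lemma Euclidean_cone_nbhd_imp_open_embedding:
  assumes nb: "Euclidean_cone_nbhd X x m L" and L: "compact_space L"
    and W: "openin X W" "x \<in> W"
  obtains e where "open_embedding (Euclidean_cone m L) X e" "e Euclidean_cone_origin = x"
    "e ` topspace (Euclidean_cone m L) \<subseteq> W"
proof -
  obtain U h where U: "U \<subseteq> topspace X" "x \<in> X interior_of U"
    and h: "homeomorphic_map (subtopology X U) (Euclidean_cone m L) h" "h x = Euclidean_cone_origin"
    using nb unfolding Euclidean_cone_nbhd_def nbhd_def by blast
  obtain g where g: "homeomorphic_maps (subtopology X U) (Euclidean_cone m L) h g"
    using h(1) homeomorphic_map_maps by blast
  define V where "V = X interior_of U \<inter> W"
  have V: "openin X V" "x \<in> V" "V \<subseteq> U" "V \<subseteq> W"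
    using U W interior_of_subset[of X U] by (auto simp: V_def)
  then have "openin (subtopology X U) V"
    by (meson openin_subtopology_Int2 subset_openin_subtopology)
  then have "openin (Euclidean_cone m L) (h ` V)" "Euclidean_cone_origin \<in> h ` V"
    using h V(2) homeomorphic_imp_open_map open_map_def by (blast, metis image_eqI)
  then obtain c where c: "open_embedding (Euclidean_cone m L) (Euclidean_cone m L) c"
    "c Euclidean_cone_origin = Euclidean_cone_origin" "c ` topspace (Euclidean_cone m L) \<subseteq> h ` V"
    using Euclidean_cone_compression[OF L] by blast
  have gh: "g (h z) = z" if "z \<in> V" for z
    using g that V(3) U(1) by (auto simp: homeomorphic_maps_def subset_iff)
  have emb: "open_embedding (Euclidean_cone m L) (subtopology X U) (g \<circ> c)"
    using c(1) g by (meson homeomorphic_maps_imp_open_embedding homeomorphic_maps_sym open_embedding_compose)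
  have into: "(g \<circ> c) ` topspace (Euclidean_cone m L) \<subseteq> V"
  proof clarsimp
    fix v z assume "v \<in> topspace (Euclidean_space m)" "z \<in> topspace (open_cone L)"
    then have "c (v, z) \<in> h ` V" using c(3) by auto
    then show "g (c (v, z)) \<in> V" using gh by auto
  qed
  have "open_map (Euclidean_cone m L) X (g \<circ> c)"
    unfolding open_map_def
  proof (intro allI impI)
    fix A assume A: "openin (Euclidean_cone m L) A"
    then have "openin (subtopology X U) ((g \<circ> c) ` A)"
      using emb by (simp add: open_embedding_def open_map_def)
    then obtain T where T: "openin X T" "(g \<circ> c) ` A = T \<inter> U"
      by (auto simp: openin_subtopology)
    have "(g \<circ> c) ` A \<subseteq> V" using into openin_subset[OF A] by blast
    then have "(g \<circ> c) ` A = T \<inter> V" using T(2) V(3) by blast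
    then show "openin X ((g \<circ> c) ` A)" using openin_Int[OF T(1) V(1)] by simp
  qed
  then have "open_embedding (Euclidean_cone m L) X (g \<circ> c)"
    using emb by (simp add: open_embedding_def continuous_map_in_subtopology)
  moreover have "(g \<circ> c) Euclidean_cone_origin = x"
    using c(2) h(2) gh[OF V(2)] by simp
  ultimately show thesis using that into V(4) by blast
qed

lemma open_embedding_imp_Euclidean_cone_nbhd:
  assumes e: "open_embedding (Euclidean_cone m L) X e" and x: "e Euclidean_cone_origin = x"
  shows "Euclidean_cone_nbhd X x m L"
proof -
  let ?U = "e ` topspace (Euclidean_cone m L)"
  obtain g where g: "homeomorphic_maps (Euclidean_cone m L) (subtopology X ?U) e g"
    using open_embedding_inverse[OF e] .
  have o: "Euclidean_cone_origin \<in> topspace (Euclidean_cone m L)" by simp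
  then have "g x = Euclidean_cone_origin"
    using g x unfolding homeomorphic_maps_def by blast
  moreover have "homeomorphic_map (subtopology X ?U) (Euclidean_cone m L) g"
    using g homeomorphic_maps_map by blast
  moreover have "openin X ?U" "x \<in> ?U"
    using open_embedding_image[OF e] o x by (blast, metis image_eqI)
  then have "nbhd X x ?U"
    by (simp add: nbhd_def openin_subset interior_of_openin)
  ultimately show ?thesis
    unfolding Euclidean_cone_nbhd_def by blast
qed

lemma Euclidean_cone_nbhd_imp_in_topspace: "Euclidean_cone_nbhd X x m L \<Longrightarrow> x \<in> topspace X"
  unfolding Euclidean_cone_nbhd_def nbhd_def by (auto dest: subsetD[OF interior_of_subset_topspace])

lemma Euclidean_cone_nbhd_local:
  assumes f: "open_embedding X Y f" and x: "x \<in> topspace X" and L: "compact_space L"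
  shows "Euclidean_cone_nbhd X x m L \<longleftrightarrow> Euclidean_cone_nbhd Y (f x) m L"
proof
  assume "Euclidean_cone_nbhd X x m L"
  then obtain e where "open_embedding (Euclidean_cone m L) X e" "e Euclidean_cone_origin = x"
    using Euclidean_cone_nbhd_imp_open_embedding[OF _ L openin_topspace x] by blast
  then show "Euclidean_cone_nbhd Y (f x) m L"
    using open_embedding_imp_Euclidean_cone_nbhd[OF open_embedding_compose[OF _ f], of m L e "f x"] by simp
next
  assume "Euclidean_cone_nbhd Y (f x) m L"
  then obtain e where e: "open_embedding (Euclidean_cone m L) Y e" "e Euclidean_cone_origin = f x"
      "e ` topspace (Euclidean_cone m L) \<subseteq> f ` topspace X"
    using Euclidean_cone_nbhd_imp_open_embedding[OF _ L open_embedding_image[OF f] imageI[OF x]] by blast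
  obtain e' where e': "open_embedding (Euclidean_cone m L) X e'"
      "\<And>z. z \<in> topspace (Euclidean_cone m L) \<Longrightarrow> f (e' z) = e z"
    using open_embedding_lift[OF f e(1,3)] by blast
  have o: "Euclidean_cone_origin \<in> topspace (Euclidean_cone m L)" by simp
  have "f (e' Euclidean_cone_origin) = f x" using e'(2)[OF o] e(2) by simp
  then have "e' Euclidean_cone_origin = x"
    using f x open_embedding_in_topspace[OF e'(1) o] by (auto simp: open_embedding_def inj_on_def)
  with e'(1) show "Euclidean_cone_nbhd X x m L"
    by (rule open_embedding_imp_Euclidean_cone_nbhd)
qed

lemma MCS_index_local:
  assumes "open_embedding X Y f" "x \<in> topspace X"
  shows "MCS_index Y (f x) = MCS_index X x"
  unfolding MCS_index_def using Euclidean_cone_nbhd_local[OF assms] by (metis (no_types, lifting))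

text \<open>
  Used with a cone for \<open>Y\<close>, this is constancy along the axis; used with a link for \<open>Y\<close>, it says that
  off the axis the position in \<open>\<real>\<^sup>m\<close> and the radius do not matter.
\<close>

lemma MCS_index_translation_invariant:
  assumes "v \<in> topspace (Euclidean_space m)" "y \<in> topspace Y"
  shows "MCS_index (prod_topology (Euclidean_space m) Y) (v, y) =
    MCS_index (prod_topology (Euclidean_space m) Y) (\<lambda>_. 0, y)"
  using MCS_index_local[OF open_embedding_Euclidean_translation[OF assms(1), of Y], of "(\<lambda>_. 0, y)"] assms
  by simp

lemma Euclidean_cone_nbhd_along_axis:
  assumes e: "open_embedding (Euclidean_cone m L) X e" and v: "v \<in> topspace (Euclidean_space m)"
  shows "Euclidean_cone_nbhd X (e (v, cone_vertex)) m L"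
  by (rule open_embedding_imp_Euclidean_cone_nbhd[OF
        open_embedding_compose[OF open_embedding_Euclidean_translation[OF v] e]]) simp

lemma homeomorphic_maps_Euclidean_space_0:
  "homeomorphic_maps Y (prod_topology (Euclidean_space 0) Y) (\<lambda>y. (\<lambda>_. 0, y)) snd"
  by (auto simp: homeomorphic_maps_def continuous_map_pairwise comp_def continuous_map_snd
      topspace_Euclidean_space fun_eq_iff)

lemma open_embedding_Euclidean_space_0:
  "open_embedding Y (prod_topology (Euclidean_space 0) Y) (\<lambda>y. (\<lambda>_. 0, y))"
  using homeomorphic_maps_Euclidean_space_0 by (rule homeomorphic_maps_imp_open_embedding)

text \<open>
  The defining neighbourhood \<open>cL\<close> is also a neighbourhood \<open>\<real>\<^sup>0 \<times> cL\<close>, hence can be made open like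
  any other.
\<close>

lemma MCS_dim_chart:
  assumes X: "MCS_dim n X" and x: "x \<in> topspace X"
  obtains L :: link and e where "n \<ge> 0" "compact_space L" "MCS_dim (n - 1) L"
    "open_embedding (open_cone L) X e" "e cone_vertex = x"
proof -
  have n: "n \<ge> 0" using assms by (auto simp: MCS_dim_def)
  have "\<forall>p\<in>topspace X. \<exists>U (L :: link) h. nbhd X p U \<and> compact_space L \<and> MCS_dim (n - 1) L \<and>
      homeomorphic_map (subtopology X U) (open_cone L) h \<and> h p = cone_vertex"
    using X MCS_dim_step[OF n, of X] by simp
  then obtain U and L :: link and h where L: "nbhd X x U" "compact_space L" "MCS_dim (n - 1) L"
      "homeomorphic_map (subtopology X U) (open_cone L) h" "h x = cone_vertex"
    using x by meson
  have z: "homeomorphic_map (open_cone L) (Euclidean_cone 0 L) (\<lambda>c. (\<lambda>_. 0, c))"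
    using homeomorphic_maps_Euclidean_space_0 homeomorphic_maps_map by blast
  have "Euclidean_cone_nbhd X x 0 L"
    unfolding Euclidean_cone_nbhd_def
  proof (intro exI conjI)
    show "((\<lambda>c. (\<lambda>_. 0, c)) \<circ> h) x = Euclidean_cone_origin" by (simp add: L(5))
  qed (fact L(1) homeomorphic_map_compose[OF L(4) z])+
  then obtain e where e: "open_embedding (Euclidean_cone 0 L) X e" "e Euclidean_cone_origin = x"
    using Euclidean_cone_nbhd_imp_open_embedding[OF _ L(2) openin_topspace x] by blast
  show thesis
    using that[OF n L(2,3) open_embedding_compose[OF open_embedding_Euclidean_space_0 e(1)]] e(2)
    by simp
qed

section \<open>Invariance of dimension\<close>

lemma Euclidean_space_subspace:
  "i \<le> m \<Longrightarrow> Euclidean_space i = subtopology (Euclidean_space m) (topspace (Euclidean_space i))"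
  by (auto simp: Euclidean_space_def subtopology_subtopology intro!: arg_cong[where f = "subtopology _"])

text \<open>
  If \<open>i < m\<close>, invariance of domain makes the image of \<open>A\<close> open in \<open>\<real>\<^sup>m\<close>; but it lies in the proper
  subspace \<open>\<real>\<^sup>i\<close> and so contains no segment in the direction of the coordinate \<open>i\<close>.
\<close>

lemma Euclidean_space_dim_le:
  assumes A: "openin (Euclidean_space m) A" "A \<noteq> {}"
    and f: "continuous_map (subtopology (Euclidean_space m) A) (Euclidean_space i) f" "inj_on f A"
  shows "m \<le> i"
proof (rule ccontr)
  assume "\<not> m \<le> i"
  then have im: "i < m" by simp
  have img: "f ` A \<subseteq> topspace (Euclidean_space i)"
    using continuous_map_image_subset_topspace[OF f(1)] openin_subset[OF A(1)]
    by (simp add: Int_absorb1)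
  have "continuous_map (subtopology (Euclidean_space m) A) (Euclidean_space m) f"
    using f(1) Euclidean_space_subspace[of i m] im by (metis continuous_map_in_subtopology less_imp_le)
  then have B: "openin (Euclidean_space m) (f ` A)"
    using A(1) f(2) invariance_of_domain_Euclidean_space by blast
  obtain a where a: "a \<in> f ` A" using A(2) by blast
  then have a0: "a \<in> topspace (Euclidean_space m)" "a i = 0"
    using img im by (auto simp: topspace_Euclidean_space)
  \<comment> \<open>The line through \<open>a\<close> in the direction of the coordinate \<open>i\<close>, which is the first one to vanish
    on \<open>\<real>\<^sup>i\<close>.\<close>
  define g where "g t j = (if j < m then (if j = i then t else a j) else 0)" for t :: real and j
  have g: "g t = a(i := t)" for t
    using a0 im by (auto simp: g_def fun_eq_iff topspace_Euclidean_space)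
  have "continuous_map euclideanreal (Euclidean_space m) g"
    unfolding g_def continuous_map_componentwise_Euclidean_space by auto
  then have "openin euclideanreal {t \<in> topspace euclideanreal. g t \<in> f ` A}"
    using B by (rule openin_continuous_map_preimage)
  moreover have "{t \<in> topspace euclideanreal. g t \<in> f ` A} = {0}"
  proof -
    have "t = 0" if "a(i := t) \<in> f ` A" for t
    proof -
      have "(a(i := t)) i = 0" using that img by (auto simp only: topspace_Euclidean_space)
      then show ?thesis by simp
    qed
    then show ?thesis using a a0(2) by (auto simp: g fun_upd_idem)
  qed
  ultimately show False by (simp add: not_open_singleton)
qed

text \<open>
  Near a common point the axis \<open>\<real>\<^sup>m\<close> of the first chart either stays in the axis \<open>\<real>\<^sup>i\<close> of the second,
  which forces \<open>m \<le> i\<close>, or reaches a point off that axis.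
\<close>

lemma Euclidean_axis_dichotomy:
  assumes e: "open_embedding (Euclidean_cone m L) Z e" and d: "open_embedding (Euclidean_cone i L') Z d"
    and meet: "e Euclidean_cone_origin \<in> d ` topspace (Euclidean_cone i L')"
  obtains "m \<le> i"
  | v u y where "v \<in> topspace (Euclidean_space m)" "u \<in> topspace (Euclidean_space (Suc i))"
    "y \<in> topspace L'" "e (v, cone_vertex) = d (punctured_cone_map i (u, y))"
proof (cases "\<exists>v\<in>topspace (Euclidean_space m). \<exists>u\<in>topspace (Euclidean_space (Suc i)).
    \<exists>y\<in>topspace L'. e (v, cone_vertex) = d (punctured_cone_map i (u, y))")
  case True
  then show ?thesis using that(2) by blast
next
  case False
  let ?D = "d ` topspace (Euclidean_cone i L')"
  obtain g where g: "homeomorphic_maps (Euclidean_cone i L') (subtopology Z ?D) d g"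
    using open_embedding_inverse[OF d] .
  define a where "a v = e (v, cone_vertex)" for v
  define A where "A = {v \<in> topspace (Euclidean_space m). a v \<in> ?D}"
  have a: "continuous_map (Euclidean_space m) Z a"
  proof -
    have "continuous_map (Euclidean_space m) (Euclidean_cone m L) (\<lambda>v. (v, cone_vertex))"
      by (simp add: continuous_map_pairwise comp_def)
    then have "continuous_map (Euclidean_space m) Z (e \<circ> (\<lambda>v. (v, cone_vertex)))"
      by (rule continuous_map_compose) (use e in \<open>simp add: open_embedding_def\<close>)
    then show ?thesis by (simp add: comp_def a_def[abs_def])
  qed
  have A: "openin (Euclidean_space m) A" "(\<lambda>_. 0) \<in> A"
    using openin_continuous_map_preimage[OF a open_embedding_image[OF d]] meet by (auto simp: A_def a_def)
  have axis: "d (fst (g (a v)), cone_vertex) = a v" if v: "v \<in> A" for v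
  proof -
    obtain z where z: "z \<in> topspace (Euclidean_cone i L')" "a v = d z" using v by (auto simp: A_def)
    then have gz: "g (a v) = z" using g unfolding homeomorphic_maps_def by metis
    from z(1) show ?thesis
    proof (cases rule: Euclidean_cone_cases)
      case (1 w)
      then show ?thesis using gz z(2) by simp
    next
      case (2 u y)
      then show ?thesis using False z(2) v by (auto simp: A_def a_def)
    qed
  qed
  have "continuous_map (subtopology (Euclidean_space m) A) (Euclidean_space i) (fst \<circ> (g \<circ> a))"
  proof (intro continuous_map_compose)
    show "continuous_map (subtopology (Euclidean_space m) A) (subtopology Z ?D) a"
      using a by (auto simp: continuous_map_in_subtopology continuous_map_from_subtopology A_def)
    show "continuous_map (subtopology Z ?D) (Euclidean_cone i L') g"
      using g by (simp add: homeomorphic_maps_def)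
  qed (rule continuous_map_fst)
  moreover have "inj_on (fst \<circ> (g \<circ> a)) A"
  proof (rule inj_onI)
    fix v w assume vw: "v \<in> A" "w \<in> A" "(fst \<circ> (g \<circ> a)) v = (fst \<circ> (g \<circ> a)) w"
    then have "fst (g (a v)) = fst (g (a w))" by simp
    then have "a v = a w" by (metis axis vw(1,2))
    then have "e (v, cone_vertex) = e (w, cone_vertex)" by (simp add: a_def)
    moreover have inj: "inj_on e (topspace (Euclidean_cone m L))" using e by (simp add: open_embedding_def)
    ultimately show "v = w"
      using inj_onD[OF inj, of "(v, cone_vertex)" "(w, cone_vertex)"] vw by (simp add: A_def)
  qed
  moreover have "A \<noteq> {}" using A(2) by blast
  ultimately have "m \<le> i" using Euclidean_space_dim_le[OF A(1)] by metis
  then show ?thesis by (rule that(1))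
qed

section \<open>Finiteness of the index\<close>

text \<open>
  The dimension drops by one when a point off the axis is reached, while the Euclidean factor \<open>\<real>\<^sup>k\<close>
  grows by one. Since such points of \<open>\<real>\<^sup>k \<times> X\<close> have neighbourhoods in \<open>\<real>\<^sup>k\<^sup>+\<^sup>1 \<times> L'\<close>, the bound has to be
  proved for all products \<open>\<real>\<^sup>k \<times> X\<close> together.
\<close>

lemma Euclidean_factor_bound_step:
  fixes X :: "'a topology" and L :: link
  assumes X: "MCS_dim n X" and nb: "Euclidean_cone_nbhd (prod_topology (Euclidean_space k) X) q m L"
    and L: "compact_space L"
    and links: "\<And>(L' :: link) q'. \<lbrakk>compact_space L'; MCS_dim (n - 1) L';
      Euclidean_cone_nbhd (prod_topology (Euclidean_space (Suc k)) L') q' m L\<rbrakk> \<Longrightarrow> int m \<le> n + int k"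
  shows "int m \<le> n + int k"
proof -
  have q: "q \<in> topspace (prod_topology (Euclidean_space k) X)"
    using nb by (rule Euclidean_cone_nbhd_imp_in_topspace)
  then obtain w x where wx: "q = (w, x)" "w \<in> topspace (Euclidean_space k)" "x \<in> topspace X" by auto
  obtain L' :: link and c where c: "n \<ge> 0" "compact_space L'" "MCS_dim (n - 1) L'"
    "open_embedding (open_cone L') X c" "c cone_vertex = x"
    using MCS_dim_chart[OF X wx(3)] .
  have d: "open_embedding (Euclidean_cone k L') (prod_topology (Euclidean_space k) X) (map_prod id c)"
    by (intro open_embedding_prod open_embedding_id c)
  obtain e where e: "open_embedding (Euclidean_cone m L) (prod_topology (Euclidean_space k) X) e"
      "e Euclidean_cone_origin = q"
    using Euclidean_cone_nbhd_imp_open_embedding[OF nb L openin_topspace q] by blast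
  have "q \<in> map_prod id c ` topspace (Euclidean_cone k L')"
    using wx c(5) by (intro image_eqI[of _ _ "(w, cone_vertex)"]) auto
  then have "e Euclidean_cone_origin \<in> map_prod id c ` topspace (Euclidean_cone k L')"
    by (simp add: e(2))
  from e(1) d this show ?thesis
  proof (cases rule: Euclidean_axis_dichotomy)
    case 1
    with c(1) show ?thesis by simp
  next
    case (2 v u y)
    have "Euclidean_cone_nbhd (prod_topology (Euclidean_space k) X) (e (v, cone_vertex)) m L"
      using Euclidean_cone_nbhd_along_axis[OF e(1) 2(1)] .
    then have "Euclidean_cone_nbhd (prod_topology (Euclidean_space (Suc k)) L') (u, y) m L"
      using Euclidean_cone_nbhd_local[OF open_embedding_compose[OF open_embedding_punctured_cone_map d] _ L,
          of "(u, y)" m] 2 by simp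
    then show ?thesis by (rule links[OF c(2,3)])
  qed
qed

lemma Euclidean_factor_bound_link:
  fixes K L :: link
  assumes "MCS_link N K" "Euclidean_cone_nbhd (prod_topology (Euclidean_space k) K) q m L"
    "compact_space L"
  shows "int m \<le> int N - 1 + int k"
  using assms
proof (induction N arbitrary: K k q)
  case 0
  then show ?case using Euclidean_cone_nbhd_imp_in_topspace by fastforce
next
  case (Suc N)
  show ?case
  proof (rule Euclidean_factor_bound_step[OF _ Suc.prems(2,3)])
    show "MCS_dim (int (Suc N) - 1) K" using Suc.prems(1) MCS_dim_link by blast
    fix L' :: link and q'
    assume "MCS_dim (int (Suc N) - 1 - 1) L'"
      and nb: "Euclidean_cone_nbhd (prod_topology (Euclidean_space (Suc k)) L') q' m L"
    then have "MCS_link N L'" using MCS_dim_link[of N L'] by simp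
    from Suc.IH[OF this nb Suc.prems(3)] show "int m \<le> int (Suc N) - 1 + int k" by simp
  qed
qed

lemma Euclidean_factor_bound:
  fixes X :: "'a topology" and L :: link
  assumes X: "MCS_dim n X" and nb: "Euclidean_cone_nbhd X x m L" and L: "compact_space L"
  shows "int m \<le> n"
proof -
  have x: "x \<in> topspace X" using nb by (rule Euclidean_cone_nbhd_imp_in_topspace)
  then have n: "n \<ge> 0" using X by (auto simp: MCS_dim_def)
  have "Euclidean_cone_nbhd (prod_topology (Euclidean_space 0) X) (\<lambda>_. 0, x) m L"
    using nb Euclidean_cone_nbhd_local[OF open_embedding_Euclidean_space_0 x L] by blast
  then have "int m \<le> n + int 0"
  proof (rule Euclidean_factor_bound_step[OF X _ L])
    fix L' :: link and q'
    assume "MCS_dim (n - 1) L'"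
      and nb: "Euclidean_cone_nbhd (prod_topology (Euclidean_space (Suc 0)) L') q' m L"
    then have "MCS_link (nat n) L'" using n MCS_dim_link[of "nat n" L'] by simp
    from Euclidean_factor_bound_link[OF this nb L] show "int m \<le> n + int 0" using n by simp
  qed
  then show ?thesis by simp
qed

lemma Euclidean_cone_nbhd_imp_MCS_index_ge:
  fixes L :: link
  assumes "Euclidean_cone_nbhd X x m L" "compact_space L" "MCS_space L"
  shows "enat m \<le> MCS_index X x"
  unfolding MCS_index_def using assms by (intro Sup_upper) blast

text \<open>
  A supremum of a finite nonempty set of natural numbers is a maximum; the set contains 0 by the
  definition of MCS spaces.
\<close>

lemma MCS_index_attained:
  assumes X: "MCS_space X" and x: "x \<in> topspace X"
  obtains i and L :: link and e where "compact_space L" "MCS_space L"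
    "open_embedding (Euclidean_cone i L) X e" "e Euclidean_cone_origin = x" "MCS_index X x = enat i"
proof -
  obtain n where n: "MCS_dim n X" using X by (auto simp: MCS_space_def)
  define S where "S = {m. \<exists>L :: link. compact_space L \<and> MCS_space L \<and> Euclidean_cone_nbhd X x m L}"
  obtain L0 :: link and c where "n \<ge> 0" and c: "compact_space L0" "MCS_dim (n - 1) L0"
    "open_embedding (open_cone L0) X c" "c cone_vertex = x"
    using MCS_dim_chart[OF n x] .
  have "Euclidean_cone_nbhd (open_cone L0) cone_vertex 0 L0"
    using Euclidean_cone_nbhd_local[OF open_embedding_Euclidean_space_0 cone_vertex_in_topspace c(1)]
      open_embedding_imp_Euclidean_cone_nbhd[OF open_embedding_id] by fastforce
  then have "0 \<in> S"
    using Euclidean_cone_nbhd_local[OF c(3) cone_vertex_in_topspace c(1)] c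
    by (auto simp: S_def MCS_space_def)
  moreover have "S \<subseteq> {..nat n}"
    using Euclidean_factor_bound[OF n] by (force simp: S_def)
  then have fin: "finite S" by (rule finite_subset) simp
  ultimately have Max: "Max S \<in> S" by (metis Max_in empty_iff)
  have "MCS_index X x = Sup (enat ` S)"
    unfolding MCS_index_def S_def by (rule arg_cong[where f = Sup]) blast
  also have "\<dots> = enat (Max S)"
    using Max fin by (intro antisym Sup_least Sup_upper) auto
  finally have "MCS_index X x = enat (Max S)" .
  moreover obtain L :: link where L: "compact_space L" "MCS_space L" "Euclidean_cone_nbhd X x (Max S) L"
    using Max by (auto simp: S_def)
  ultimately show thesis
    using Euclidean_cone_nbhd_imp_open_embedding[OF L(3,1) openin_topspace x] that[OF L(1,2)] by blast
qed

text \<open>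
  A neighbourhood \<open>cL'\<close> of \<open>y\<close> in \<open>L\<close> with \<open>L'\<close> an MCS space gives \<open>\<real>\<^sup>k \<times> cL'\<close> in \<open>\<real>\<^sup>k \<times> L\<close>.
\<close>

lemma MCS_index_product_ge:
  assumes L: "MCS_space L" and uy: "u \<in> topspace (Euclidean_space k)" "y \<in> topspace L"
  shows "enat k \<le> MCS_index (prod_topology (Euclidean_space k) L) (u, y)"
proof -
  obtain n where n: "MCS_dim n L" using L by (auto simp: MCS_space_def)
  obtain L' :: link and c where "n \<ge> 0" and c: "compact_space L'" "MCS_dim (n - 1) L'"
    "open_embedding (open_cone L') L c" "c cone_vertex = y"
    using MCS_dim_chart[OF n uy(2)] .
  have "Euclidean_cone_nbhd (prod_topology (Euclidean_space k) L) (\<lambda>_. 0, y) k L'"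
    by (rule open_embedding_imp_Euclidean_cone_nbhd[OF open_embedding_prod[OF open_embedding_id c(3)]])
      (simp add: c(4))
  then have "enat k \<le> MCS_index (prod_topology (Euclidean_space k) L) (\<lambda>_. 0, y)"
    using c by (intro Euclidean_cone_nbhd_imp_MCS_index_ge) (auto simp: MCS_space_def)
  then show ?thesis using MCS_index_translation_invariant[OF uy] by simp
qed

section \<open>The index in a chart\<close>

text \<open>
  The last condition says that the chart is optimal, that is, attains the index at its centre.
\<close>

definition MCS_chart :: "'a topology \<Rightarrow> nat \<Rightarrow> link \<Rightarrow> ((nat \<Rightarrow> real) \<times> (nat \<Rightarrow> real) cone \<Rightarrow> 'a) \<Rightarrow> bool"
  where "MCS_chart X i L d \<longleftrightarrow> compact_space L \<and> MCS_space L \<and>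
    open_embedding (Euclidean_cone i L) X d \<and> MCS_index X (d Euclidean_cone_origin) = enat i"

lemma MCS_chart_imp_open_embedding: "MCS_chart X i L d \<Longrightarrow> open_embedding (Euclidean_cone i L) X d"
  by (simp add: MCS_chart_def)

lemma MCS_chart_exists:
  assumes "MCS_space X" "x \<in> topspace X"
  obtains i L d where "MCS_chart X i L d" "d Euclidean_cone_origin = x"
proof -
  obtain i and L :: link and d where "compact_space L" "MCS_space L"
    "open_embedding (Euclidean_cone i L) X d" "d Euclidean_cone_origin = x" "MCS_index X x = enat i"
    using MCS_index_attained[OF assms] .
  then show thesis by (intro that[of i L d]) (simp_all add: MCS_chart_def)
qed

lemma MCS_chart_index_axis:
  assumes d: "MCS_chart X i L d" and v: "v \<in> topspace (Euclidean_space i)"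
  shows "MCS_index X (d (v, cone_vertex)) = enat i"
proof -
  have emb: "open_embedding (Euclidean_cone i L) X d" using d by (rule MCS_chart_imp_open_embedding)
  show ?thesis
    using d v MCS_index_local[OF emb, of "(v, cone_vertex)"] MCS_index_local[OF emb, of Euclidean_cone_origin]
      MCS_index_translation_invariant[OF v, of cone_vertex "open_cone L"]
    by (simp add: MCS_chart_def)
qed

lemma MCS_chart_index_off_axis:
  assumes d: "MCS_chart X i L d" and uy: "u \<in> topspace (Euclidean_space (Suc i))" "y \<in> topspace L"
  shows "MCS_index X (d (punctured_cone_map i (u, y))) =
    MCS_index (prod_topology (Euclidean_space (Suc i)) L) (\<lambda>_. 0, y)"
proof -
  have "open_embedding (prod_topology (Euclidean_space (Suc i)) L) X (d \<circ> punctured_cone_map i)"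
    using d by (intro open_embedding_compose[OF open_embedding_punctured_cone_map]) (simp add: MCS_chart_def)
  from MCS_index_local[OF this, of "(u, y)"] show ?thesis
    using uy MCS_index_translation_invariant[OF uy] by simp
qed

lemma MCS_chart_index_off_axis_gt:
  assumes d: "MCS_chart X i L d" and uy: "u \<in> topspace (Euclidean_space (Suc i))" "y \<in> topspace L"
  shows "enat (Suc i) \<le> MCS_index X (d (punctured_cone_map i (u, y)))"
  unfolding MCS_chart_index_off_axis[OF assms]
  using MCS_index_product_ge[of L "\<lambda>_. 0" "Suc i" y] d uy by (simp add: MCS_chart_def)

lemma MCS_chart_index_ge:
  assumes d: "MCS_chart X i L d" and z: "z \<in> topspace (Euclidean_cone i L)"
  shows "enat i \<le> MCS_index X (d z)"
  using z
proof (cases rule: Euclidean_cone_cases)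
  case (1 v)
  then show ?thesis using MCS_chart_index_axis[OF d] by simp
next
  case (2 u y)
  then show ?thesis
    using order_trans[OF _ MCS_chart_index_off_axis_gt[OF d], of "enat i" u y] by simp
qed

lemma MCS_chart_index_eq_iff:
  assumes d: "MCS_chart X i L d" and z: "z \<in> topspace (Euclidean_cone i L)"
  shows "MCS_index X (d z) = enat i \<longleftrightarrow> snd z = cone_vertex"
  using z
proof (cases rule: Euclidean_cone_cases)
  case (1 v)
  then show ?thesis using MCS_chart_index_axis[OF d] by simp
next
  case (2 u y)
  then have "enat (Suc i) \<le> MCS_index X (d z)" using MCS_chart_index_off_axis_gt[OF d] by simp
  then have "MCS_index X (d z) \<noteq> enat i" by auto
  then show ?thesis using 2 by simp
qed

lemma homeomorphic_map_MCS_chart_axis: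
  assumes d: "MCS_chart X i L d"
  shows "homeomorphic_map (Euclidean_space i)
    (subtopology X ((\<lambda>v. d (v, cone_vertex)) ` topspace (Euclidean_space i))) (\<lambda>v. d (v, cone_vertex))"
proof -
  have "embedding_map (Euclidean_space i) (Euclidean_cone i L) (\<lambda>v. (v, cone_vertex))"
    by (simp add: embedding_map_graph)
  moreover have "embedding_map (Euclidean_cone i L) X d"
    using d by (simp add: MCS_chart_def open_embedding_eq_embedding_map)
  ultimately have "embedding_map (Euclidean_space i) X (d \<circ> (\<lambda>v. (v, cone_vertex)))"
    by (rule embedding_map_compose)
  then show ?thesis by (simp add: embedding_map_def comp_def)
qed

lemma MCS_chart_axis_eq_stratum:
  assumes d: "MCS_chart X i L d"
  shows "(\<lambda>v. d (v, cone_vertex)) ` topspace (Euclidean_space i) =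
    d ` topspace (Euclidean_cone i L) \<inter> {x \<in> topspace X. MCS_index X x = enat i}" (is "?A = ?B")
proof
  have emb: "open_embedding (Euclidean_cone i L) X d" using d by (simp add: MCS_chart_def)
  show "?A \<subseteq> ?B"
    using MCS_chart_index_axis[OF d] open_embedding_in_topspace[OF emb] by (auto intro!: imageI)
  show "?B \<subseteq> ?A"
  proof
    fix x assume "x \<in> ?B"
    then obtain z where z: "z \<in> topspace (Euclidean_cone i L)" "x = d z" "MCS_index X (d z) = enat i" by auto
    then have "snd z = cone_vertex" using MCS_chart_index_eq_iff[OF d] by blast
    then show "x \<in> ?A" using z(1,2) by (intro image_eqI[of _ _ "fst z"]) (auto simp: prod_eq_iff)
  qed
qed

section \<open>The two stratifications coincide\<close>

lemma MCS_space_imp_metrizable: "MCS_space X \<Longrightarrow> metrizable_space X"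
proof (unfold MCS_space_def MCS_dim_def, elim exE disjE conjE)
  assume "topspace X = {}"
  then show "metrizable_space X" by (metis null_topspace_iff_trivial metrizable_space_discrete_topology)
qed

text \<open>
  Along the axis of a neighbourhood \<open>\<real>\<^sup>m \<times> cL\<close>, with \<open>L\<close> an arbitrary compactum, the MCS index is
  constant, so the axis cannot leave the axis of an optimal chart, where the MCS index jumps up.
\<close>

lemma intrinsic_index_eq_MCS_index:
  assumes X: "MCS_space X" and x: "x \<in> topspace X"
  shows "intrinsic_index X x = MCS_index X x"
proof (rule antisym)
  show "MCS_index X x \<le> intrinsic_index X x"
    unfolding MCS_index_def intrinsic_index_def
    by (rule Sup_subset_mono) (use MCS_space_imp_metrizable in blast)
next
  obtain i L' d where d: "MCS_chart X i L' d" "d Euclidean_cone_origin = x"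
    using MCS_chart_exists[OF X x] .
  have emb: "open_embedding (Euclidean_cone i L') X d" using d by (simp add: MCS_chart_def)
  have ind: "MCS_index X x = enat i" using d by (simp add: MCS_chart_def)
  show "intrinsic_index X x \<le> MCS_index X x"
    unfolding intrinsic_index_def
  proof (rule Sup_least, clarify)
    fix m and L :: link
    assume L: "compact_space L" and nb: "Euclidean_cone_nbhd X x m L"
    obtain e where e: "open_embedding (Euclidean_cone m L) X e" "e Euclidean_cone_origin = x"
      using Euclidean_cone_nbhd_imp_open_embedding[OF nb L openin_topspace x] by blast
    have "Euclidean_cone_origin \<in> topspace (Euclidean_cone i L')" by simp
    then have "e Euclidean_cone_origin \<in> d ` topspace (Euclidean_cone i L')"
      using d(2) e(2) by (metis image_eqI)
    from e(1) emb this show "enat m \<le> MCS_index X x"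
    proof (cases rule: Euclidean_axis_dichotomy)
      case 1
      then show ?thesis by (simp add: ind)
    next
      case (2 v u y)
      have "MCS_index X (e (v, cone_vertex)) = MCS_index X x"
        using MCS_index_local[OF e(1), of "(v, cone_vertex)"] MCS_index_local[OF e(1), of Euclidean_cone_origin]
          MCS_index_translation_invariant[OF 2(1), of cone_vertex "open_cone L"] 2(1) e(2) by simp
      moreover have "enat (Suc i) \<le> MCS_index X (e (v, cone_vertex))"
        using MCS_chart_index_off_axis_gt[OF d(1) 2(2,3)] 2(4) by simp
      ultimately show ?thesis by (simp add: ind)
    qed
  qed
qed

section \<open>The stratified structure\<close>

text \<open>
  The bound \<open>c\<close> matters for the lowest stratum only, which has nothing subtracted from it.
\<close>

lemma stratum_sublevel:
  assumes "\<And>x. x \<in> S \<Longrightarrow> enat c \<le> f x"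
  shows "stratum (\<lambda>j. {x \<in> S. f x \<le> enat (c + j)}) j = {x \<in> S. f x = enat (c + j)}"
proof (cases j)
  case 0
  then show ?thesis using assms by (auto simp: stratum_def intro: antisym)
next
  case (Suc k)
  have "a \<le> enat (c + Suc k) \<and> \<not> a \<le> enat (c + k) \<longleftrightarrow> a = enat (c + Suc k)" for a
    by (cases a) auto
  then show ?thesis unfolding stratum_def Suc by auto
qed

text \<open>
  The index is lower semicontinuous: in an optimal chart it is smallest on the axis.
\<close>

lemma closedin_MCS_index_sublevel:
  assumes X: "MCS_space X"
  shows "closedin X {x \<in> topspace X. MCS_index X x \<le> enat j}"
  unfolding closedin_def
proof (intro conjI)
  show "openin X (topspace X - {x \<in> topspace X. MCS_index X x \<le> enat j})" (is "openin X ?C")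
  proof (subst openin_subopen, intro ballI)
    fix x assume "x \<in> ?C"
    then have x: "x \<in> topspace X" "\<not> MCS_index X x \<le> enat j" by auto
    obtain i L d where d: "MCS_chart X i L d" "d Euclidean_cone_origin = x"
      using MCS_chart_exists[OF X x(1)] .
    have emb: "open_embedding (Euclidean_cone i L) X d" using d by (simp add: MCS_chart_def)
    have "\<not> enat i \<le> enat j" using d x by (simp add: MCS_chart_def)
    then have "d ` topspace (Euclidean_cone i L) \<subseteq> ?C"
      using MCS_chart_index_ge[OF d(1)] open_embedding_in_topspace[OF emb] order_trans by blast
    moreover have "x \<in> d ` topspace (Euclidean_cone i L)"
      using d(2) by (intro image_eqI[of _ _ Euclidean_cone_origin]) auto
    ultimately show "\<exists>T. openin X T \<and> x \<in> T \<and> T \<subseteq> ?C"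
      using open_embedding_image[OF emb] by blast
  qed
qed auto

lemma connected_components_open:
  assumes "\<And>y. y \<in> S \<Longrightarrow> \<exists>A B. openin X A \<and> connectedin X B \<and> y \<in> A \<and> A \<inter> S \<subseteq> B \<and> B \<subseteq> S"
    and C: "C \<in> connected_components_of (subtopology X S)"
  shows "openin (subtopology X S) C"
proof (subst openin_subopen, intro ballI)
  fix y assume y: "y \<in> C"
  then have yS: "y \<in> topspace X" "y \<in> S"
    using connected_components_of_subset[OF C] by auto
  then obtain A B where AB: "openin X A" "connectedin X B" "y \<in> A" "A \<inter> S \<subseteq> B" "B \<subseteq> S"
    using assms(1) by meson
  have "B \<subseteq> C"
    by (rule connected_components_of_maximal[OF C])
      (use AB y yS in \<open>auto simp: connectedin_subtopology disjnt_def\<close>)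
  then show "\<exists>T. openin (subtopology X S) T \<and> y \<in> T \<and> T \<subseteq> C"
    using AB yS by (intro exI[of _ "A \<inter> S"]) (auto simp: openin_subtopology)
qed

text \<open>
  This serves both \<open>X\<close> itself (with \<open>n = 0\<close>) and the links (with \<open>\<real>\<^sup>i\<^sup>+\<^sup>1 \<times> L\<close> embedded as the complement
  of an axis). Sublevel sets of the index on \<open>Y\<close> are pulled back from \<open>X\<close>, hence closed. For the
  components, an optimal chart of \<open>\<real>\<^sup>n \<times> Y\<close> at \<open>(0, y)\<close> is transported from \<open>X\<close>; its axis is connected and
  its projection to \<open>Y\<close> stays in the stratum and fills a neighbourhood of \<open>y\<close> there, because the
  index on \<open>\<real>\<^sup>n \<times> Y\<close> depends on the second coordinate only.
\<close>

lemma stratified_set_Euclidean_factor: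
  fixes Y :: "'b topology" and X :: "'a topology"
  defines "J \<equiv> \<lambda>n y. MCS_index (prod_topology (Euclidean_space n) Y) (\<lambda>_. 0, y)"
  assumes X: "MCS_space X" and f: "open_embedding (prod_topology (Euclidean_space n) Y) X f"
    and Y: "metrizable_space Y" and c: "\<And>y. y \<in> topspace Y \<Longrightarrow> enat c \<le> J n y"
  shows "stratified_set Y (\<lambda>j. {y \<in> topspace Y. J n y \<le> enat (c + j)})"
proof -
  let ?P = "prod_topology (Euclidean_space n) Y"
  define g where "g y = (\<lambda>_::nat. 0::real, y)" for y :: 'b
  have g: "continuous_map Y ?P g"
    by (simp add: g_def[abs_def] continuous_map_pairwise comp_def)
  have gP: "g y \<in> topspace ?P" if "y \<in> topspace Y" for y
    using that by (simp add: g_def)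
  have J: "J n y = MCS_index X (f (g y))" if "y \<in> topspace Y" for y
    using MCS_index_local[OF f gP[OF that]] by (simp add: J_def g_def)
  have Jsnd: "MCS_index ?P q = J n (snd q)" if "q \<in> topspace ?P" for q
    using that MCS_index_translation_invariant[of "fst q" n "snd q" Y] by (auto simp: J_def)
  have "closedin Y {y \<in> topspace Y. J n y \<le> enat j}" for j
  proof -
    have "continuous_map Y X (f \<circ> g)"
      using g f by (auto simp: open_embedding_def intro: continuous_map_compose)
    then have "closedin Y {y \<in> topspace Y. (f \<circ> g) y \<in> {x \<in> topspace X. MCS_index X x \<le> enat j}}"
      by (rule closedin_continuous_map_preimage) (rule closedin_MCS_index_sublevel[OF X])
    moreover have "{y \<in> topspace Y. (f \<circ> g) y \<in> {x \<in> topspace X. MCS_index X x \<le> enat j}} =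
        {y \<in> topspace Y. J n y \<le> enat j}"
      using J open_embedding_in_topspace[OF f gP] by auto
    ultimately show ?thesis by simp
  qed
  moreover have "openin (subtopology Y {y \<in> topspace Y. J n y = enat k}) C"
    if C: "C \<in> connected_components_of (subtopology Y {y \<in> topspace Y. J n y = enat k})" for k C
  proof (rule connected_components_open[OF _ C])
    let ?T = "{y \<in> topspace Y. J n y = enat k}"
    fix y assume y: "y \<in> ?T"
    have fgy: "f (g y) \<in> topspace X"
      using y open_embedding_in_topspace[OF f gP] by simp
    obtain i L d where d: "MCS_chart X i L d" "d Euclidean_cone_origin = f (g y)"
      using MCS_chart_exists[OF X fgy] .
    then have i: "i = k" using y J[of y] by (simp add: MCS_chart_def)
    have L: "compact_space L" "MCS_space L" using d by (simp_all add: MCS_chart_def)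
    have "Euclidean_cone_nbhd X (f (g y)) k L"
      using d i by (intro open_embedding_imp_Euclidean_cone_nbhd[of k L X d]) (simp_all add: MCS_chart_def)
    then have "Euclidean_cone_nbhd ?P (g y) k L"
      using Euclidean_cone_nbhd_local[OF f gP L(1)] y by blast
    then obtain e where e: "open_embedding (Euclidean_cone k L) ?P e" "e Euclidean_cone_origin = g y"
      using Euclidean_cone_nbhd_imp_open_embedding[OF _ L(1) openin_topspace gP] y by blast
    then have ch: "MCS_chart ?P k L e"
      using L y by (simp add: MCS_chart_def J_def g_def)
    define A where "A = {y' \<in> topspace Y. g y' \<in> e ` topspace (Euclidean_cone k L)}"
    define B where "B = (snd \<circ> (\<lambda>v. e (v, cone_vertex))) ` topspace (Euclidean_space k)"
    have axis: "(\<lambda>v. e (v, cone_vertex)) ` topspace (Euclidean_space k) =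
        e ` topspace (Euclidean_cone k L) \<inter> {q \<in> topspace ?P. MCS_index ?P q = enat k}"
      by (rule MCS_chart_axis_eq_stratum[OF ch])
    have "openin Y A"
      unfolding A_def by (rule openin_continuous_map_preimage[OF g open_embedding_image[OF e(1)]])
    moreover have "connectedin Y B"
      unfolding B_def
    proof (rule connectedin_continuous_map_image)
      have "continuous_map (Euclidean_space k) ?P (\<lambda>v. e (v, cone_vertex))"
        using homeomorphic_imp_continuous_map[OF homeomorphic_map_MCS_chart_axis[OF ch]]
        by (simp add: continuous_map_in_subtopology)
      then show "continuous_map (Euclidean_space k) Y (snd \<circ> (\<lambda>v. e (v, cone_vertex)))"
        by (rule continuous_map_compose) (rule continuous_map_snd)
    qed (simp add: connectedin_topspace connected_Euclidean_space)
    moreover have "y \<in> A"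
      using e(2) y unfolding A_def by (auto intro!: image_eqI[of _ _ Euclidean_cone_origin])
    moreover have "A \<inter> ?T \<subseteq> B"
    proof
      fix y' assume y': "y' \<in> A \<inter> ?T"
      then have "g y' \<in> e ` topspace (Euclidean_cone k L) \<inter> {q \<in> topspace ?P. MCS_index ?P q = enat k}"
        using gP[of y'] Jsnd[OF gP, of y'] by (auto simp: A_def g_def)
      then obtain v where v: "v \<in> topspace (Euclidean_space k)" "g y' = e (v, cone_vertex)"
        unfolding axis[symmetric] by blast
      have "snd (g y') = y'" by (simp add: g_def)
      then show "y' \<in> B" unfolding B_def using v by (intro image_eqI[of _ _ v]) simp_all
    qed
    moreover have "B \<subseteq> ?T"
    proof
      fix y' assume "y' \<in> B"
      then obtain q where q: "q \<in> (\<lambda>v. e (v, cone_vertex)) ` topspace (Euclidean_space k)" "y' = snd q"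
        unfolding B_def image_comp[symmetric] by blast
      then show "y' \<in> ?T" using Jsnd[of q] unfolding axis by auto
    qed
    ultimately show "\<exists>A B. openin Y A \<and> connectedin Y B \<and> y \<in> A \<and> A \<inter> ?T \<subseteq> B \<and> B \<subseteq> ?T"
      by blast
  qed
  moreover have "{y \<in> topspace Y. J n y \<le> enat (c + j)} \<subseteq> {y \<in> topspace Y. J n y \<le> enat (c + Suc j)}" for j
    by (auto intro: order_trans)
  moreover have "stratum (\<lambda>j. {y \<in> topspace Y. J n y \<le> enat (c + j)}) j =
      {y \<in> topspace Y. J n y = enat (c + j)}" for j
    by (rule stratum_sublevel) (rule c)
  ultimately show ?thesis
    unfolding stratified_set_def using Y by simp
qed

lemma stratum_MCS_stratification:
  "stratum (MCS_stratification X) i = {x \<in> topspace X. MCS_index X x = enat i}"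
  using stratum_sublevel[of "topspace X" 0 "MCS_index X" i]
  by (simp add: MCS_stratification_def[abs_def] zero_enat_def[symmetric])

lemma stratified_set_MCS_stratification:
  assumes X: "MCS_space X"
  shows "stratified_set X (MCS_stratification X)"
proof -
  have "open_embedding (prod_topology (Euclidean_space 0) X) X snd"
    using homeomorphic_maps_Euclidean_space_0 homeomorphic_maps_sym homeomorphic_maps_imp_open_embedding by blast
  from stratified_set_Euclidean_factor[OF X this MCS_space_imp_metrizable[OF X], of 0]
  have "stratified_set X (\<lambda>j. {y \<in> topspace X. MCS_index (prod_topology (Euclidean_space 0) X) (\<lambda>_. 0, y) \<le> enat j})"
    by (simp add: zero_enat_def[symmetric])
  moreover have "{y \<in> topspace X. MCS_index (prod_topology (Euclidean_space 0) X) (\<lambda>_. 0, y) \<le> enat j} =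
      MCS_stratification X j" for j
    using MCS_index_local[OF open_embedding_Euclidean_space_0, of _ X]
    by (auto simp: MCS_stratification_def)
  ultimately show ?thesis by simp
qed

lemma topological_manifold_MCS_stratum:
  assumes X: "MCS_space X"
  shows "topological_manifold i (subtopology X {x \<in> topspace X. MCS_index X x = enat i})"
  unfolding topological_manifold_def
proof (intro conjI ballI)
  let ?S = "{x \<in> topspace X. MCS_index X x = enat i}"
  show "metrizable_space (subtopology X ?S)"
    by (intro metrizable_space_subtopology MCS_space_imp_metrizable X)
  fix x assume "x \<in> topspace (subtopology X ?S)"
  then have x: "x \<in> topspace X" "MCS_index X x = enat i" by auto
  obtain i' L d where "MCS_chart X i' L d" "d Euclidean_cone_origin = x"
    using MCS_chart_exists[OF X x(1)] .
  then have d: "MCS_chart X i L d" "d Euclidean_cone_origin = x"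
    using x(2) by (auto simp: MCS_chart_def)
  let ?U = "(\<lambda>v. d (v, cone_vertex)) ` topspace (Euclidean_space i)"
  have U: "?U = d ` topspace (Euclidean_cone i L) \<inter> ?S"
    by (rule MCS_chart_axis_eq_stratum[OF d(1)])
  have "openin (subtopology X ?S) ?U"
    unfolding U openin_subtopology
    using open_embedding_image[OF MCS_chart_imp_open_embedding[OF d(1)]] by blast
  moreover have "x \<in> ?U" using d(2) by (intro image_eqI[of _ _ "\<lambda>_. 0"]) auto
  moreover have "openin (Euclidean_space i) (topspace (Euclidean_space i))" by simp
  moreover have "subtopology (subtopology X ?S) ?U homeomorphic_space
      subtopology (Euclidean_space i) (topspace (Euclidean_space i))"
  proof -
    have "subtopology (subtopology X ?S) ?U = subtopology X ?U"
      unfolding subtopology_subtopology U by (rule arg_cong[where f = "subtopology X"]) blast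
    moreover have "subtopology X ?U homeomorphic_space Euclidean_space i"
      by (rule homeomorphic_space_sym[THEN iffD1],
          rule homeomorphic_map_imp_homeomorphic_space[OF homeomorphic_map_MCS_chart_axis[OF d(1)]])
    ultimately show ?thesis by (simp only: subtopology_topspace)
  qed
  ultimately show "\<exists>U V. openin (subtopology X ?S) U \<and> x \<in> U \<and> openin (Euclidean_space i) V \<and>
      subtopology (subtopology X ?S) U homeomorphic_space subtopology (Euclidean_space i) V"
    by blast
qed

section \<open>Links of points of MCS spaces\<close>

lemma cone_filtration_mono:
  assumes "\<And>j. G j \<subseteq> G (Suc j)" "a \<le> b"
  shows "cone_filtration G a \<subseteq> cone_filtration G b"
proof (cases a)
  case 0
  then show ?thesis by (auto simp: cone_filtration_def cone_set_def)
next
  case (Suc a')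
  have "G (a - 1) \<subseteq> G (b - 1)"
    by (rule lift_Suc_mono_le[of G, OF assms(1)]) (use assms(2) in simp)
  then show ?thesis using Suc assms(2) by (auto simp: cone_filtration_def cone_set_def)
qed

lemma prod_filtration_manifold_cone:
  assumes "\<And>j. G j \<subseteq> G (Suc j)"
  shows "prod_filtration (manifold_filtration i U) (cone_filtration G) k =
    (if i \<le> k then U \<times> cone_filtration G (k - i) else {})"
proof -
  have "z \<in> prod_filtration (manifold_filtration i U) (cone_filtration G) k \<longleftrightarrow>
      i \<le> k \<and> z \<in> U \<times> cone_filtration G (k - i)" for z
  proof
    assume "z \<in> prod_filtration (manifold_filtration i U) (cone_filtration G) k"
    then obtain a b where ab: "a + b = k" "z \<in> manifold_filtration i U a \<times> cone_filtration G b"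
      by (auto simp: prod_filtration_def)
    then have "i \<le> a" "b \<le> k - i" by (auto simp: manifold_filtration_def split: if_splits)
    then show "i \<le> k \<and> z \<in> U \<times> cone_filtration G (k - i)"
      using ab cone_filtration_mono[of G b "k - i", OF assms] by (auto simp: manifold_filtration_def)
  next
    assume *: "i \<le> k \<and> z \<in> U \<times> cone_filtration G (k - i)"
    then show "z \<in> prod_filtration (manifold_filtration i U) (cone_filtration G) k"
      unfolding prod_filtration_def
      by (intro UN_I[of "(i, k - i)"]) (auto simp: manifold_filtration_def)
  qed
  then show ?thesis by auto
qed

text \<open>
  The stratum of \<open>y \<in> L\<close> is governed by the index of the points of the ray through \<open>y\<close> in
  \<open>\<real>\<^sup>i \<times> cL\<close>. The cone shifts filtrations by one and the manifold factor by \<open>i\<close>, whence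
  the shift by \<open>i + 1\<close>.
\<close>

definition link_stratification :: "nat \<Rightarrow> 'a topology \<Rightarrow> nat \<Rightarrow> 'a set"
  where "link_stratification i L j = {y \<in> topspace L.
    MCS_index (prod_topology (Euclidean_space (Suc i)) L) (\<lambda>_. 0, y) \<le> enat (Suc i + j)}"

lemma link_stratification_mono: "link_stratification i L j \<subseteq> link_stratification i L (Suc j)"
  by (auto simp: link_stratification_def intro: order_trans)

lemma stratified_set_link:
  assumes X: "MCS_space X" and d: "MCS_chart X i L d"
  shows "stratified_set L (link_stratification i L)"
  unfolding link_stratification_def[abs_def]
proof (rule stratified_set_Euclidean_factor[OF X])
  have L: "MCS_space L" using d by (simp add: MCS_chart_def)
  then show "metrizable_space L" by (rule MCS_space_imp_metrizable)
  show "open_embedding (prod_topology (Euclidean_space (Suc i)) L) X (d \<circ> punctured_cone_map i)"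
    using d by (intro open_embedding_compose[OF open_embedding_punctured_cone_map]) (simp add: MCS_chart_def)
  show "enat (Suc i) \<le> MCS_index (prod_topology (Euclidean_space (Suc i)) L) (\<lambda>_. 0, y)"
    if "y \<in> topspace L" for y
    using MCS_index_product_ge[OF L _ that] by simp
qed

lemma MCS_chart_filtration:
  assumes d: "MCS_chart X i L d" and z: "z \<in> topspace (Euclidean_cone i L)"
  shows "MCS_index X (d z) \<le> enat k \<longleftrightarrow>
    i \<le> k \<and> snd z \<in> cone_filtration (link_stratification i L) (k - i)"
  using z
proof (cases rule: Euclidean_cone_cases)
  case (1 v)
  then show ?thesis
    using MCS_chart_index_axis[OF d 1(1)] by (auto simp: cone_filtration_def cone_set_def)
next
  case (2 u y)
  let ?J = "MCS_index (prod_topology (Euclidean_space (Suc i)) L) (\<lambda>_. 0, y)"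
  have J: "MCS_index X (d z) = ?J" using MCS_chart_index_off_axis[OF d 2(1,2)] 2(3) by simp
  have ge: "enat (Suc i) \<le> ?J" using MCS_chart_index_off_axis_gt[OF d 2(1,2)] 2(3) J by simp
  show ?thesis
  proof (cases "Suc i \<le> k")
    case True
    then show ?thesis using 2 J
      by (simp add: cone_filtration_def link_stratification_def punctured_cone_map_def)
  next
    case False
    then have "\<not> ?J \<le> enat k" using ge order_trans by fastforce
    moreover have "\<not> (i \<le> k \<and> snd z \<in> cone_filtration (link_stratification i L) (k - i))"
      using False 2(3) by (auto simp: cone_filtration_def)
    ultimately show ?thesis by (simp add: J)
  qed
qed

text \<open>
  The isomorphism is the chart itself, with \<open>\<real>\<^sup>i\<close> replaced by the part \<open>U\<close> of the stratum that it
  parametrises.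
\<close>

lemma MCS_chart_local_product:
  assumes d: "MCS_chart X i L d"
  defines "U \<equiv> (\<lambda>v. d (v, cone_vertex)) ` topspace (Euclidean_space i)"
    and "N \<equiv> d ` topspace (Euclidean_cone i L)"
  obtains h where "stratified_iso (prod_topology (subtopology X U) (open_cone L))
    (prod_filtration (manifold_filtration i U) (cone_filtration (link_stratification i L)))
    (subtopology X N) (\<lambda>k. N \<inter> MCS_stratification X k) h"
proof -
  have emb: "open_embedding (Euclidean_cone i L) X d" using d by (simp add: MCS_chart_def)
  obtain b where b: "homeomorphic_maps (Euclidean_space i) (subtopology X U) (\<lambda>v. d (v, cone_vertex)) b"
    using homeomorphic_map_MCS_chart_axis[OF d] unfolding U_def homeomorphic_map_maps by blast
  then have bh: "homeomorphic_map (subtopology X U) (Euclidean_space i) b"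
    using homeomorphic_maps_map by blast
  have UX: "U \<subseteq> topspace X" using open_embedding_in_topspace[OF emb] by (auto simp: U_def)
  have bU: "b ` U = topspace (Euclidean_space i)"
    using homeomorphic_imp_surjective_map[OF bh] UX by (simp add: Int_absorb1)
  have "homeomorphic_map (prod_topology (subtopology X U) (open_cone L)) (Euclidean_cone i L) (map_prod b id)"
    using open_embedding_prod[OF homeomorphic_map_imp_open_embedding[OF bh] open_embedding_id, of "open_cone L"]
      bU UX
    by (intro bijective_open_imp_homeomorphic_map)
      (simp_all add: open_embedding_def map_prod_image Int_absorb1 del: map_prod_simp)
  moreover have "homeomorphic_map (Euclidean_cone i L) (subtopology X N) d"
    using emb by (simp add: N_def open_embedding_eq_embedding_map embedding_map_def)
  ultimately have "homeomorphic_map (prod_topology (subtopology X U) (open_cone L)) (subtopology X N)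
      (d \<circ> map_prod b id)"
    by (rule homeomorphic_map_compose)
  moreover have "(d \<circ> map_prod b id) ` prod_filtration (manifold_filtration i U)
      (cone_filtration (link_stratification i L)) k = N \<inter> MCS_stratification X k" for k
  proof -
    let ?CF = "cone_filtration (link_stratification i L) (k - i)"
    have CF: "?CF \<subseteq> topspace (open_cone L)"
      by (auto simp: cone_filtration_def topspace_open_cone cone_set_def link_stratification_def)
    have "(d \<circ> map_prod b id) ` prod_filtration (manifold_filtration i U)
        (cone_filtration (link_stratification i L)) k =
        d ` (if i \<le> k then topspace (Euclidean_space i) \<times> ?CF else {})"
      unfolding prod_filtration_manifold_cone[of "link_stratification i L", OF link_stratification_mono]
      by (cases "i \<le> k")
        (simp_all only: if_True if_False image_comp[symmetric] map_prod_image bU image_id id_apply image_empty)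
    also have "\<dots> = d ` {z \<in> topspace (Euclidean_cone i L). MCS_index X (d z) \<le> enat k}"
      using CF MCS_chart_filtration[OF d] by (intro arg_cong[where f = "image d"]) auto
    also have "\<dots> = N \<inter> MCS_stratification X k"
      using open_embedding_in_topspace[OF emb] by (auto simp: N_def MCS_stratification_def intro!: imageI)
    finally show ?thesis .
  qed
  ultimately show thesis using that unfolding stratified_iso_def by blast
qed

theorem theorem1:
  fixes X :: "'a topology"
  assumes "MCS_space X"
  shows "CS_set X (MCS_stratification X) \<and>
    (\<forall>i. MCS_stratification X i = intrinsic_stratification X i)"
proof
  show "\<forall>i. MCS_stratification X i = intrinsic_stratification X i"
    using intrinsic_index_eq_MCS_index[OF assms]
    by (auto simp: MCS_stratification_def intrinsic_stratification_def)
  show "CS_set X (MCS_stratification X)"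
    unfolding CS_set_def
  proof (intro conjI allI ballI)
    show "stratified_set X (MCS_stratification X)"
      by (rule stratified_set_MCS_stratification[OF assms])
    show "topological_manifold i (subtopology X (stratum (MCS_stratification X) i))" for i
      unfolding stratum_MCS_stratification by (rule topological_manifold_MCS_stratum[OF assms])
    fix p assume p: "p \<in> topspace X"
    obtain i L d where d: "MCS_chart X i L d" "d Euclidean_cone_origin = p"
      using MCS_chart_exists[OF assms p] .
    let ?U = "(\<lambda>v. d (v, cone_vertex)) ` topspace (Euclidean_space i)"
    let ?N = "d ` topspace (Euclidean_cone i L)"
    have N: "openin X ?N" using open_embedding_image[OF MCS_chart_imp_open_embedding[OF d(1)]] .
    have U: "?U = ?N \<inter> stratum (MCS_stratification X) i"
      unfolding stratum_MCS_stratification by (rule MCS_chart_axis_eq_stratum[OF d(1)])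
    have "p \<in> ?U" using d(2) by (intro image_eqI[of _ _ "\<lambda>_. 0"]) auto
    moreover from this have "p \<in> stratum (MCS_stratification X) i" "p \<in> ?N" using U by blast+
    moreover have "openin (subtopology X (stratum (MCS_stratification X) i)) ?U"
      unfolding U openin_subtopology using N by blast
    moreover have "compact_space L" using d(1) by (simp add: MCS_chart_def)
    moreover have "stratified_set L (link_stratification i L)"
      by (rule stratified_set_link[OF assms d(1)])
    moreover have "nbhd X p ?N"
      using N \<open>p \<in> ?N\<close> by (simp add: nbhd_def openin_subset interior_of_openin)
    moreover obtain h where "stratified_iso (prod_topology (subtopology X ?U) (open_cone L))
        (prod_filtration (manifold_filtration i ?U) (cone_filtration (link_stratification i L)))
        (subtopology X ?N) (\<lambda>k. ?N \<inter> MCS_stratification X k) h"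
      using MCS_chart_local_product[OF d(1)] .
    ultimately show "\<exists>i. p \<in> stratum (MCS_stratification X) i \<and>
       (\<exists>U (L :: link) G N h.
          openin (subtopology X (stratum (MCS_stratification X) i)) U \<and> p \<in> U \<and>
          compact_space L \<and> stratified_set L G \<and>
          nbhd X p N \<and>
          stratified_iso
            (prod_topology (subtopology X U) (open_cone L))
            (prod_filtration (manifold_filtration i U) (cone_filtration G))
            (subtopology X N) (\<lambda>k. N \<inter> MCS_stratification X k) h)"
      by blast
  qed
qed

end
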